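(* Let $d\ge2$ and $t\in\mathbb{N}$. The set $\mathcal{X}_n=\{\mathbf{x}_1,\ldots,\mathbf{x}_n\}\subseteq\mathbb{S}^d_+$ is a hemispherical $t$-design if and only if $$\sum_{i=1}^nB^d_{\ell,k}(\mathbf{x}_i)=0\qquad\text{for all }k\in\mathcal{I}^d_\ell,\ \ell=1,2,\ldots,t.$$
   Context: $\mathbb{N}=\{1,2,\ldots\}$, $\mathbb{N}_0=\{0\}\cup\mathbb{N}$. $\mathbb{S}^d=\{\mathbf{x}\in\mathbb{R}^{d+1}:\|\mathbf{x}\|=1\}$ with surface measure $\omega_d$; $\mathbb{S}^d_+=\{\mathbf{x}\in\mathbb{S}^d:x_{d+1}\ge0\}$, with surface area $|\mathbb{S}^d_+|$. $\mathbb{P}_t$ is the space of spherical polynomials of degree at most $t$ (restrictions to the sphere of real polynomials in $d+1$ variables of total degree at most $t$). A finite set $\{\mathbf{x}_1,\ldots,\mathbf{x}_n\}\subseteq\mathbb{S}^d_+$ is a hemispherical $t$-design if $\frac{1}{|\mathbb{S}^d_+|}\int_{\mathbb{S}^d_+}P\,d\omega_d=\frac1n\sum_{i=1}^nP(\mathbf{x}_i)$ for all $P\in\mathbb{P}_t$. Index set: $\mathcal{I}^d_\ell=\{k=(k_1,\ldots,k_{d-1})\in\mathbb{N}_0\times\cdots\times\mathbb{N}_0\times\mathbb{Z}: |k_{d-1}|\le k_{d-2}\le\cdots\le k_1\le\ell\}$ (for $d=2$: $k=k_1\in\mathbb{Z}$ with $|k_1|\le\ell$). One-variable polynomials: for $i\in\mathbb{N}_0$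 let $\lambda_i=i+\frac{d-2}{2}$ and $f_{r,i}=\int_0^1x^r(1-x^2)^{\lambda_i}dx$, $r\in\mathbb{N}_0$. Let $p_{0,i}=1$, and for $j>0$ let $p_{j,i}(x)=\frac{1}{\Delta^i_{j-1}}\det M_{j,i}(x)$, where $M_{j,i}(x)$ is the $(j+1)\times(j+1)$ matrix whose row number $a$ ($a=0,\ldots,j-1$) is $(f_{a,i},f_{a+1,i},\ldots,f_{a+j,i})$ and whose last row is $(1,x,\ldots,x^j)$, and $\Delta^i_{j-1}=\det(f_{a+b,i})_{a,b=0}^{j-1}$. Put $\Psi_{j,i}(x)=p_{j,i}(x)\big/\big(\int_0^1p_{j,i}(u)^2(1-u^2)^{\lambda_i}du\big)^{1/2}$ for $x\in[0,1]$. Spherical harmonics: $\{Y^{d-1}_k\}$ is the real orthonormal system of spherical harmonics on $\mathbb{S}^{d-1}$ indexed by $k=(k_1,\ldots,k_{d-1})\in\bigcup_\ell\mathcal{I}_\ell^d$, with $Y_k^{d-1}$ of degree $|k_1|$, those with $|k_1|=m$ forming an orthonormal basis of the spherical harmonics of degree $m$ on $\mathbb{S}^{d-1}$. For $\ell\in\mathbb{N}_0$, $k\in\mathcal{I}^d_\ell$ and $\mathbf{x}=(\bar{\mathbf{x}}\sin\theta,\cos\theta)\in\mathbb{S}^d_+$ with $\bar{\mathbf{x}}\in\mathbb{S}^{d-1}$, $\theta\in[0,\frac{\pi}{2}]$, $$B^d_{\ell,k}(\mathbf{x})=(\sin\theta)^{|k_1|}\,\Psi_{\ell-|k_1|,|k_1|}(\cos\theta)\,Y^{d-1}_k(\bar{\mathbf{x}}).$$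 (For $d\ge3$, $|k_1|=k_1$.) *)

theory Defs
  imports
    "HOL-Analysis.Analysis"
    "Jordan_Normal_Form.Determinant"
begin

hide_const (open) Determinants.det  \<comment> \<open>the matrices below have variable size\<close>

section \<open>Surface measure on the unit sphere\<close>

text \<open>
  The surface measure of the unit sphere of an \<open>N\<close>-dimensional Euclidean space, as a Borel measure
  on the ambient space that is concentrated on the sphere: a Borel set \<open>A\<close> of the sphere has
  measure \<open>N\<close> times the volume of the cone \<open>{r x | x \<in> A, 0 < r \<le> 1}\<close>. It is not normalised; see
  \<open>emeasure_surface_measure_sphere\<close>.
\<close>

definition surface_measure :: "'a::euclidean_space measure" where
  "surface_measure =
     scale_measure (of_nat DIM('a)) (distr (restrict_space lborel (cball 0 1 - {0})) borel sgn)"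

lemma measurable_sgn_restrict [measurable]:
  "sgn \<in> measurable (restrict_space lborel (cball 0 1 - {0})) (borel :: 'a::euclidean_space measure)"
proof -
  have "(\<lambda>x::'a. x /\<^sub>R norm x) \<in> borel_measurable borel"
    by measurable
  then have "sgn \<in> borel_measurable (borel :: 'a measure)"
    by (simp add: sgn_div_norm[abs_def])
  then show ?thesis
    by (intro measurable_restrict_space1) simp
qed

lemma emeasure_surface_measure:
  fixes A :: "'a::euclidean_space set"
  assumes "A \<in> sets borel" "A \<subseteq> sphere 0 1"
  shows "emeasure surface_measure A =
           of_nat DIM('a) * emeasure lborel {r *\<^sub>R x | r x. x \<in> A \<and> 0 < r \<and> r \<le> 1}"
proof -
  let ?R = "restrict_space lborel (cball 0 1 - {0}) :: 'a measure"
  have eq: "sgn -` A \<inter> space ?R = {r *\<^sub>R x | r x. x \<in> A \<and> 0 < r \<and> r \<le> 1}" (is "?L = ?C")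
  proof (intro equalityI subsetI)
    fix y assume "y \<in> ?L"
    then have "sgn y \<in> A" "y \<noteq> 0" "norm y \<le> 1" by (auto simp: space_restrict_space)
    then show "y \<in> ?C"
      by (intro CollectI exI[of _ "norm y"] exI[of _ "sgn y"]) (auto simp: sgn_div_norm)
  next
    fix y assume "y \<in> ?C"
    then obtain r x where "y = r *\<^sub>R x" "x \<in> A" "0 < r" "r \<le> 1" by blast
    moreover from this assms have "norm x = 1" by auto
    ultimately show "y \<in> ?L"
      by (auto simp: space_restrict_space sgn_div_norm)
  qed
  have "emeasure surface_measure A = of_nat DIM('a) * emeasure ?R (sgn -` A \<inter> space ?R)"
    unfolding surface_measure_def emeasure_scale_measure
    by (subst emeasure_distr[OF measurable_sgn_restrict]) (use assms in auto)
  also have "emeasure ?R (sgn -` A \<inter> space ?R) = emeasure lborel (sgn -` A \<inter> space ?R)"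
    by (rule emeasure_restrict_space) (auto simp: space_restrict_space)
  finally show ?thesis by (simp only: eq)
qed

lemma emeasure_surface_measure_sphere:
  "emeasure surface_measure (sphere (0::'a::euclidean_space) 1) =
     of_nat DIM('a) * emeasure lborel (cball (0::'a) 1)"
proof -
  have "{r *\<^sub>R x | r x. x \<in> sphere (0::'a) 1 \<and> 0 < r \<and> r \<le> 1} = cball 0 1 - {0}" (is "?C = _")
  proof (intro equalityI subsetI)
    fix y :: 'a assume "y \<in> cball 0 1 - {0}"
    then show "y \<in> ?C"
      by (intro CollectI exI[of _ "norm y"] exI[of _ "sgn y"]) (auto simp: sgn_div_norm)
  qed auto
  moreover have "emeasure lborel (cball (0::'a) 1 - {0}) = emeasure lborel (cball (0::'a) 1)"
    by (rule emeasure_Diff_null_set) (auto intro: finite_imp_null_set_lborel)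
  ultimately show ?thesis
    by (simp add: emeasure_surface_measure)
qed

section \<open>Spherical polynomials and spherical harmonics\<close>

definition monomial :: "('a::euclidean_space \<Rightarrow> nat) \<Rightarrow> 'a \<Rightarrow> real" where
  "monomial \<alpha> x = (\<Prod>b\<in>Basis. inner x b ^ \<alpha> b)"

definition monomial_degree :: "('a::euclidean_space \<Rightarrow> nat) \<Rightarrow> nat" where
  "monomial_degree \<alpha> = (\<Sum>b\<in>Basis. \<alpha> b)"

definition polynomials_le :: "nat \<Rightarrow> ('a::euclidean_space \<Rightarrow> real) set" where
  "polynomials_le t = {\<lambda>x. \<Sum>\<alpha>\<in>A. c \<alpha> * monomial \<alpha> x | A c.
     finite A \<and> (\<forall>\<alpha>\<in>A. monomial_degree \<alpha> \<le> t)}"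

definition homogeneous_polynomials :: "nat \<Rightarrow> ('a::euclidean_space \<Rightarrow> real) set" where
  "homogeneous_polynomials m = {\<lambda>x. \<Sum>\<alpha>\<in>A. c \<alpha> * monomial \<alpha> x | A c.
     finite A \<and> (\<forall>\<alpha>\<in>A. monomial_degree \<alpha> = m)}"

definition laplacian :: "('a::euclidean_space \<Rightarrow> real) \<Rightarrow> 'a \<Rightarrow> real" where
  "laplacian p x = (\<Sum>b\<in>Basis. (deriv ^^ 2) (\<lambda>s::real. p (x + s *\<^sub>R b)) 0)"

definition spherical_polynomials :: "nat \<Rightarrow> ('a::euclidean_space \<Rightarrow> real) set" where
  "spherical_polynomials t = (\<lambda>p. restrict p (sphere 0 1)) ` polynomials_le t"

definition spherical_harmonics :: "nat \<Rightarrow> ('a::euclidean_space \<Rightarrow> real) set" where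
  "spherical_harmonics m =
     (\<lambda>p. restrict p (sphere 0 1)) ` {p \<in> homogeneous_polynomials m. \<forall>x. laplacian p x = 0}"

section \<open>Hemispherical designs\<close>

text \<open>
  \<open>\<real>\<^sup>d\<^sup>+\<^sup>1\<close> is \<open>\<real>\<^sup>d \<times> \<real>\<close>, that is, \<open>(real ^ 'n) \<times> real\<close> with \<open>CARD('n) = d\<close>; the last coordinate
  of \<open>x\<close> is \<open>snd x\<close>.
\<close>

definition hemisphere :: "((real ^ 'n::finite) \<times> real) set" where
  "hemisphere = {x \<in> sphere 0 1. snd x \<ge> 0}"

definition hemispherical_design :: "nat \<Rightarrow> ((real ^ 'n::finite) \<times> real) set \<Rightarrow> bool" where
  "hemispherical_design t X \<longleftrightarrow>
     finite X \<and> X \<noteq> {} \<and> X \<subseteq> hemisphere \<and>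
     (\<forall>P\<in>spherical_polynomials t.
        1 / measure surface_measure (hemisphere :: ((real ^ 'n) \<times> real) set) *
          (LINT x:hemisphere|surface_measure. P x) =
        1 / real (card X) * (\<Sum>x\<in>X. P x))"

section \<open>The functions \<open>B\<close>\<close>

text \<open>
  The tuple \<open>(k\<^sub>1, \<dots>, k\<^bsub>d-1\<^esub>)\<close> is a list of length \<open>d - 1\<close>, so that \<open>k\<^sub>j\<close> is \<open>k ! (j - 1)\<close>. Only the
  last entry may be negative; absolute values are redundant at all other positions.
\<close>

definition index_set :: "nat \<Rightarrow> nat \<Rightarrow> int list set" where
  "index_set d l = {k. length k = d - 1 \<and> (\<forall>i<d - 2. 0 \<le> k ! i) \<and>
     \<bar>k ! 0\<bar> \<le> int l \<and> (\<forall>i<d - 2. \<bar>k ! Suc i\<bar> \<le> k ! i)}"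

definition index_degree :: "int list \<Rightarrow> nat" where
  "index_degree k = nat \<bar>k ! 0\<bar>"

definition spherical_harmonic_system :: "(int list \<Rightarrow> real ^ 'n::finite \<Rightarrow> real) \<Rightarrow> bool" where
  "spherical_harmonic_system Y \<longleftrightarrow>
     (let K = (\<Union>l. index_set CARD('n) l) in
       (\<forall>k\<in>K. Y k \<in> spherical_harmonics (index_degree k)) \<and>
       (\<forall>k\<in>K. \<forall>k'\<in>K.
          (LINT u:sphere 0 1|surface_measure. Y k u * Y k' u) = (if k = k' then 1 else 0)) \<and>
       (\<forall>m. \<forall>h\<in>spherical_harmonics m. \<exists>c. \<forall>u\<in>sphere 0 1.
          h u = (\<Sum>k | k \<in> K \<and> index_degree k = m. c k * Y k u)))"

lemma finite_index_set_degree: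
  assumes "d \<ge> 2"
  shows "finite {k \<in> (\<Union>l. index_set d l). index_degree k = m}"
proof (rule finite_subset)
  show "{k \<in> (\<Union>l. index_set d l). index_degree k = m} \<subseteq>
          {k. set k \<subseteq> {- int m..int m} \<and> length k = d - 1}"
  proof
    fix k assume "k \<in> {k \<in> (\<Union>l. index_set d l). index_degree k = m}"
    then have len: "length k = d - 1" and k0: "\<bar>k ! 0\<bar> = int m"
      and step: "\<And>i. i < d - 2 \<Longrightarrow> \<bar>k ! Suc i\<bar> \<le> k ! i"
      by (auto simp: index_set_def index_degree_def)
    have "\<bar>k ! i\<bar> \<le> int m" if "i < d - 1" for i
      using that
    proof (induction i)
      case (Suc i)
      then have "\<bar>k ! Suc i\<bar> \<le> k ! i" by (intro step) simp
      with Suc show ?case by simp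
    qed (simp add: k0)
    then have "set k \<subseteq> {- int m..int m}"
      by (fastforce simp: in_set_conv_nth len abs_le_iff)
    with len show "k \<in> {k. set k \<subseteq> {- int m..int m} \<and> length k = d - 1}"
      by simp
  qed
qed (rule finite_lists_length_eq, simp)

definition lam :: "nat \<Rightarrow> nat \<Rightarrow> real" where
  "lam d i = real i + (real d - 2) / 2"

definition moment :: "nat \<Rightarrow> nat \<Rightarrow> nat \<Rightarrow> real" where
  "moment d i r = integral {0..1} (\<lambda>x. x ^ r * (1 - x\<^sup>2) powr lam d i)"

definition p_poly :: "nat \<Rightarrow> nat \<Rightarrow> nat \<Rightarrow> real \<Rightarrow> real" where
  "p_poly d j i x =
     (if j = 0 then 1
      else 1 / det (mat j j (\<lambda>(a, b). moment d i (a + b))) *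
           det (mat (j + 1) (j + 1) (\<lambda>(a, b). if a < j then moment d i (a + b) else x ^ b)))"

definition Psi :: "nat \<Rightarrow> nat \<Rightarrow> nat \<Rightarrow> real \<Rightarrow> real" where
  "Psi d j i x =
     p_poly d j i x / sqrt (integral {0..1} (\<lambda>u. (p_poly d j i u)\<^sup>2 * (1 - u\<^sup>2) powr lam d i))"

definition polar_rep :: "(real ^ 'n::finite) \<times> real \<Rightarrow> (real ^ 'n) \<times> real" where
  "polar_rep x =
     (SOME (u, \<theta>). u \<in> sphere 0 1 \<and> \<theta> \<in> {0..pi/2} \<and> x = (sin \<theta> *\<^sub>R u, cos \<theta>))"

text \<open>
  The choice in \<open>polar_rep\<close> is ambiguous only at the north pole, where it does not affect
  \<open>B_fun\<close>; see \<open>B_fun_polar\<close>.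
\<close>

definition B_fun ::
    "(int list \<Rightarrow> real ^ 'n::finite \<Rightarrow> real) \<Rightarrow> nat \<Rightarrow> int list \<Rightarrow> (real ^ 'n) \<times> real \<Rightarrow> real" where
  "B_fun Y l k x =
     (let (u, \<theta>) = polar_rep x; m = index_degree k
      in sin \<theta> ^ m * Psi CARD('n) (l - m) m (cos \<theta>) * Y k u)"

lemma spherical_harmonics_0_const:
  assumes "h \<in> spherical_harmonics 0" "u \<in> sphere 0 1" "v \<in> sphere 0 1"
  shows "h u = h (v :: 'a::euclidean_space)"
proof -
  obtain A c where A: "\<forall>\<alpha>\<in>A. monomial_degree \<alpha> = 0"
    and h: "h = restrict (\<lambda>x. \<Sum>\<alpha>\<in>A. c \<alpha> * monomial \<alpha> x) (sphere (0::'a) 1)"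
    using assms(1) unfolding spherical_harmonics_def homogeneous_polynomials_def by blast
  have "monomial \<alpha> u = monomial \<alpha> v" if "\<alpha> \<in> A" for \<alpha>
    unfolding monomial_def using A that by (intro prod.cong) (auto simp: monomial_degree_def)
  then show ?thesis using assms by (auto simp: h intro!: sum.cong)
qed

lemma B_fun_polar:
  fixes u :: "real ^ 'n::finite"
  assumes Y: "spherical_harmonic_system Y" and k: "k \<in> index_set CARD('n) l"
    and u: "u \<in> sphere 0 1" and \<theta>: "\<theta> \<in> {0..pi/2}"
  shows "B_fun Y l k (sin \<theta> *\<^sub>R u, cos \<theta>) =
    sin \<theta> ^ index_degree k * Psi CARD('n) (l - index_degree k) (index_degree k) (cos \<theta>) * Y k u"
proof -
  let ?Q = "\<lambda>(v, \<eta>). v \<in> sphere 0 1 \<and> \<eta> \<in> {0..pi/2} \<and>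
    (sin \<theta> *\<^sub>R u, cos \<theta>) = (sin \<eta> *\<^sub>R v, cos \<eta>)"
  obtain v \<eta> where pr: "polar_rep (sin \<theta> *\<^sub>R u, cos \<theta>) = (v, \<eta>)" by (cases "polar_rep (sin \<theta> *\<^sub>R u, cos \<theta>)")
  have "?Q (u, \<theta>)" using u \<theta> by simp
  then have "?Q (polar_rep (sin \<theta> *\<^sub>R u, cos \<theta>))"
    unfolding polar_rep_def by (rule someI[of ?Q])
  then have v: "v \<in> sphere 0 1" and \<eta>: "\<eta> \<in> {0..pi/2}"
    and eq: "sin \<theta> *\<^sub>R u = sin \<eta> *\<^sub>R v" "cos \<theta> = cos \<eta>"
    by (auto simp: pr)
  have [simp]: "\<eta> = \<theta>" using eq(2) \<theta> \<eta> by (auto intro: cos_inj_pi)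
  have "sin \<theta> ^ index_degree k * Y k v = sin \<theta> ^ index_degree k * Y k u"
  proof (cases "sin \<theta> = 0 \<and> index_degree k = 0")
    case True
    have "Y k \<in> spherical_harmonics (index_degree k)"
      using Y k unfolding spherical_harmonic_system_def Let_def by blast
    then show ?thesis using True spherical_harmonics_0_const[of "Y k" u v] u v by simp
  next
    case False
    show ?thesis
    proof (cases "sin \<theta> = 0")
      case True
      with False show ?thesis by simp
    next
      case False
      with eq show ?thesis by simp
    qed
  qed
  then show ?thesis by (auto simp: B_fun_def Let_def pr)
qed

end

theory Submission
  imports Defs
begin

text \<open>
  Write a point of the hemisphere as \<open>(y, s)\<close> with \<open>y\<close> in the equatorial space and \<open>s\<close> its height, and
  let \<open>m\<close> be the degree of \<open>Y\<^sub>k\<close>. The factor \<open>sin \<theta> ^ m\<close> makes \<open>B\<^bsub>l,k\<^esub>\<close> the product of the homogeneous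
  extension of \<open>Y\<^sub>k\<close>, evaluated at \<open>y\<close>, and a polynomial of degree \<open>l - m\<close> in \<open>s\<close>
  (\<open>B_fun_polynomial\<close>). So \<open>B\<^bsub>l,k\<^esub>\<close> is a polynomial of degree at most \<open>l\<close> on the hemisphere. The theorem
  then follows from two facts.

  First, \<open>B\<^bsub>l,k\<^esub>\<close> has integral \<open>0\<close> for \<open>l \<ge> 1\<close> (\<open>B_fun_integral_zero\<close>). The integral of a product of a
  homogeneous polynomial in \<open>y\<close> and a polynomial in \<open>s\<close> factors into an integral over the equator and a
  weighted integral over \<open>[0, 1]\<close> (\<open>hemisphere_integral_product\<close>). If \<open>m > 0\<close>, the first factor
  is \<open>0\<close> by orthogonality of \<open>Y\<^sub>k\<close> to constants; if \<open>m = 0\<close>, the second is \<open>0\<close> because \<open>p\<^bsub>l,0\<^esub>\<close> is orthogonal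
  to constants. Hence a set averages \<open>B\<^bsub>l,k\<^esub>\<close> correctly if and only if its sum over the set is \<open>0\<close>, and a
  design has this property for \<open>1 \<le> l \<le> t\<close>.

  Second, the \<open>B\<^bsub>l,k\<^esub>\<close> with \<open>l \<le> t\<close> span the polynomials of degree at most \<open>t\<close> on the hemisphere, which gives
  the converse. A homogeneous polynomial in \<open>y\<close> is a sum of harmonic ones times powers of
  \<open>\<bar>y\<bar>\<^sup>2\<close> (\<open>harmonic_decomposition\<close>), and \<open>\<bar>y\<bar>\<^sup>2 = 1 - s\<^sup>2\<close>. The harmonic parts are combinations of the
  \<open>Y\<^sub>k\<close>, and polynomials in \<open>s\<close> are combinations of the \<open>\<Psi>\<^bsub>j,m\<^esub>\<close>, since \<open>p\<^bsub>j,m\<^esub>\<close> has degree exactly \<open>j\<close>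
  (\<open>poly_in_span_Psi\<close>); this rests on the positive definiteness of the moment matrices.

  The surface measure is defined by cones. It is related to volume integrals only through homogeneous
  functions of degree \<open>r\<close>, for which the surface integral is the dimension plus \<open>r\<close> times the
  integral over the ball (\<open>sphere_integral_homogeneous\<close>).
\<close>

section \<open>Homogeneous polynomials\<close>

text \<open>
  Homogeneous polynomials and polynomials of bounded degree are both spans of the monomials that
  satisfy some condition; the closure properties are the same for every condition.
\<close>

definition monomial_combinations :: "(('a::euclidean_space \<Rightarrow> nat) \<Rightarrow> bool) \<Rightarrow> ('a \<Rightarrow> real) set" where
  "monomial_combinations D =
     {\<lambda>x. \<Sum>\<alpha>\<in>A. c \<alpha> * monomial \<alpha> x | A c. finite A \<and> (\<forall>\<alpha>\<in>A. D \<alpha>)}"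

lemma homogeneous_polynomials_eq: "homogeneous_polynomials m = monomial_combinations (\<lambda>\<alpha>. monomial_degree \<alpha> = m)"
  by (simp add: homogeneous_polynomials_def monomial_combinations_def)

lemma polynomials_le_eq: "polynomials_le t = monomial_combinations (\<lambda>\<alpha>. monomial_degree \<alpha> \<le> t)"
  by (simp add: polynomials_le_def monomial_combinations_def)

lemma monomial_combinations_zero: "(\<lambda>_. 0) \<in> monomial_combinations D"
  unfolding monomial_combinations_def by (auto intro!: exI[of _ "{}"])

lemma monomial_combinations_step:
  assumes "p \<in> monomial_combinations D" "D \<alpha>"
  shows "(\<lambda>x. c * monomial \<alpha> x + p x) \<in> monomial_combinations D"
proof -
  obtain A e where A: "finite A" "\<forall>\<alpha>\<in>A. D \<alpha>"
    and p: "p = (\<lambda>x. \<Sum>\<alpha>\<in>A. e \<alpha> * monomial \<alpha> x)"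
    using assms(1) unfolding monomial_combinations_def by blast
  let ?e = "\<lambda>\<beta>. (if \<beta> = \<alpha> then c else 0) + (if \<beta> \<in> A then e \<beta> else 0)"
  have "c * monomial \<alpha> x + p x = (\<Sum>\<beta>\<in>insert \<alpha> A. ?e \<beta> * monomial \<beta> x)" for x
  proof -
    have "(\<Sum>\<beta>\<in>insert \<alpha> A. ?e \<beta> * monomial \<beta> x) =
        (\<Sum>\<beta>\<in>insert \<alpha> A. if \<beta> = \<alpha> then c * monomial \<beta> x else 0) +
        (\<Sum>\<beta>\<in>insert \<alpha> A. if \<beta> \<in> A then e \<beta> * monomial \<beta> x else 0)"
      unfolding sum.distrib[symmetric] by (intro sum.cong) (auto simp: algebra_simps)
    also have "(\<Sum>\<beta>\<in>insert \<alpha> A. if \<beta> = \<alpha> then c * monomial \<beta> x else 0) = c * monomial \<alpha> x"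
      using A by (simp add: sum.delta)
    also have "(\<Sum>\<beta>\<in>insert \<alpha> A. if \<beta> \<in> A then e \<beta> * monomial \<beta> x else 0) = p x"
      unfolding p using A(1) by (intro sum.mono_neutral_cong_right) auto
    finally show ?thesis by simp
  qed
  then have "(\<lambda>x. c * monomial \<alpha> x + p x) = (\<lambda>x. \<Sum>\<beta>\<in>insert \<alpha> A. ?e \<beta> * monomial \<beta> x)" by blast
  moreover have "finite (insert \<alpha> A)" "\<forall>\<beta>\<in>insert \<alpha> A. D \<beta>" using A assms(2) by auto
  ultimately show ?thesis
    unfolding monomial_combinations_def by (intro CollectI exI[of _ "insert \<alpha> A"] exI[of _ ?e] conjI)
qed

text \<open>
  Adding one monomial at a time reduces linear statements about polynomials to monomials.
\<close>

lemma monomial_combinations_induct [consumes 1, case_names zero step]: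
  assumes "p \<in> monomial_combinations D"
    and zero: "P (\<lambda>_. 0)"
    and step: "\<And>c \<alpha> p. D \<alpha> \<Longrightarrow> p \<in> monomial_combinations D \<Longrightarrow> P p \<Longrightarrow>
          P (\<lambda>x. c * monomial \<alpha> x + p x)"
  shows "P p"
proof -
  obtain A e where A: "finite A" "\<forall>\<alpha>\<in>A. D \<alpha>"
    and p: "p = (\<lambda>x. \<Sum>\<alpha>\<in>A. e \<alpha> * monomial \<alpha> x)"
    using assms(1) unfolding monomial_combinations_def by blast
  have "(\<lambda>x. \<Sum>\<alpha>\<in>A. e \<alpha> * monomial \<alpha> x) \<in> monomial_combinations D \<and>
    P (\<lambda>x. \<Sum>\<alpha>\<in>A. e \<alpha> * monomial \<alpha> x)"
    using A
  proof (induction A rule: finite_induct)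
    case empty
    then show ?case using zero monomial_combinations_zero by simp
  next
    case (insert \<alpha> A)
    let ?q = "\<lambda>x. \<Sum>\<alpha>\<in>A. e \<alpha> * monomial \<alpha> x"
    have q: "?q \<in> monomial_combinations D" "P ?q" and \<alpha>: "D \<alpha>"
      using insert by auto
    show ?case
      using monomial_combinations_step[of ?q D \<alpha> "e \<alpha>", OF q(1) \<alpha>] step[OF \<alpha> q, of "e \<alpha>"]
      by (simp only: sum.insert[OF insert(1,2)])
  qed
  then show ?thesis unfolding p by blast
qed

lemma monomial_combinations_add:
  assumes "p \<in> monomial_combinations D" "q \<in> monomial_combinations D"
  shows "(\<lambda>x. p x + q x) \<in> monomial_combinations D"
  using assms(1)
proof (induction rule: monomial_combinations_induct)
  case (step c \<alpha> p)
  then show ?case using monomial_combinations_step[of "\<lambda>x. p x + q x" D \<alpha> c] by (simp add: add.assoc)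
qed (use assms(2) in simp)

lemma monomial_combinations_mono:
  assumes "p \<in> monomial_combinations D" "\<And>\<alpha>. D \<alpha> \<Longrightarrow> D' \<alpha>"
  shows "p \<in> monomial_combinations D'"
  using assms unfolding monomial_combinations_def by blast

lemma monomial_combinations_sum:
  assumes "\<And>i. i \<in> I \<Longrightarrow> p i \<in> monomial_combinations D"
  shows "(\<lambda>x. \<Sum>i\<in>I. p i x) \<in> monomial_combinations D"
  using assms
  by (induction I rule: infinite_finite_induct)
     (auto intro: monomial_combinations_zero monomial_combinations_add)

lemmas homogeneous_polynomials_zero = monomial_combinations_zero
  [where D = "\<lambda>\<alpha>. monomial_degree \<alpha> = m" for m, folded homogeneous_polynomials_eq]

lemmas homogeneous_polynomials_step = monomial_combinations_step
  [where D = "\<lambda>\<alpha>. monomial_degree \<alpha> = m" for m, folded homogeneous_polynomials_eq]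

lemmas homogeneous_polynomials_induct [consumes 1, case_names zero step] = monomial_combinations_induct
  [where D = "\<lambda>\<alpha>. monomial_degree \<alpha> = m" for m, folded homogeneous_polynomials_eq]

lemmas homogeneous_polynomials_add = monomial_combinations_add
  [where D = "\<lambda>\<alpha>. monomial_degree \<alpha> = m" for m, folded homogeneous_polynomials_eq]

lemmas homogeneous_polynomials_sum = monomial_combinations_sum
  [where D = "\<lambda>\<alpha>. monomial_degree \<alpha> = m" for m, folded homogeneous_polynomials_eq]

lemma homogeneous_polynomials_monomial:
  "monomial_degree \<alpha> = m \<Longrightarrow> (\<lambda>x. c * monomial \<alpha> x) \<in> homogeneous_polynomials m"
  using homogeneous_polynomials_step[OF homogeneous_polynomials_zero, of \<alpha> m c] by simp

lemma homogeneous_polynomials_cmult: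
  assumes "p \<in> homogeneous_polynomials m"
  shows "(\<lambda>x. c * p x) \<in> homogeneous_polynomials m"
  using assms
proof (induction rule: homogeneous_polynomials_induct)
  case (step e \<alpha> p)
  then show ?case
    using homogeneous_polynomials_step[of "\<lambda>x. c * p x" m \<alpha> "c * e"] by (simp add: algebra_simps)
qed (use homogeneous_polynomials_zero in simp)

lemma homogeneous_polynomials_scaleR:
  assumes "p \<in> homogeneous_polynomials m"
  shows "p (c *\<^sub>R x) = c ^ m * p x"
  using assms
proof (induction rule: homogeneous_polynomials_induct)
  case (step e \<alpha> p)
  have "monomial \<alpha> (c *\<^sub>R x) = c ^ m * monomial \<alpha> x"
    using step(1) by (auto simp: monomial_def monomial_degree_def power_mult_distrib prod.distrib power_sum)
  then show ?case using step by (simp add: algebra_simps)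
qed simp

lemma continuous_on_monomial [continuous_intros]: "continuous_on S (monomial \<alpha>)"
  unfolding monomial_def by (intro continuous_intros)

lemma homogeneous_polynomials_continuous:
  assumes "p \<in> homogeneous_polynomials m"
  shows "continuous_on S p"
  using assms
  by (induction rule: homogeneous_polynomials_induct) (auto intro!: continuous_intros)

lemma monomial_degree_fun_upd:
  fixes b :: "'a::euclidean_space"
  assumes "b \<in> Basis"
  shows "monomial_degree (\<alpha>(b := k)) + \<alpha> b = monomial_degree \<alpha> + k"
  using assms unfolding monomial_degree_def
  by (subst (1 2) sum.remove[of _ b]) (auto intro!: sum.cong)

lemma monomial_fun_upd:
  fixes b :: "'a::euclidean_space"
  assumes "b \<in> Basis"
  shows "monomial (\<alpha>(b := k)) x = inner x b ^ k * (\<Prod>a\<in>Basis - {b}. inner x a ^ \<alpha> a)"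
  using assms unfolding monomial_def
  by (subst prod.remove[of _ b]) (auto intro!: prod.cong)

lemma homogeneous_polynomials_coord_mult:
  fixes b :: "'a::euclidean_space"
  assumes b: "b \<in> Basis" and p: "p \<in> homogeneous_polynomials m"
  shows "(\<lambda>x. inner x b * p x) \<in> homogeneous_polynomials (Suc m)"
  using p
proof (induction rule: homogeneous_polynomials_induct)
  case (step c \<alpha> p)
  have "monomial (\<alpha>(b := Suc (\<alpha> b))) x = inner x b * monomial \<alpha> x" for x
    using monomial_fun_upd[OF b, of \<alpha> _ x] monomial_fun_upd[OF b, of \<alpha> "\<alpha> b" x] by simp
  moreover have "monomial_degree (\<alpha>(b := Suc (\<alpha> b))) = Suc m"
    using monomial_degree_fun_upd[OF b, of \<alpha> "Suc (\<alpha> b)"] step(1) by simp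
  ultimately show ?case
    using homogeneous_polynomials_step[OF step(3), of "\<alpha>(b := Suc (\<alpha> b))" c]
    by (simp add: algebra_simps)
qed (use homogeneous_polynomials_zero in simp)

lemma homogeneous_polynomials_norm_mult:
  fixes p :: "'a::euclidean_space \<Rightarrow> real"
  assumes "p \<in> homogeneous_polynomials m"
  shows "(\<lambda>x. inner x x * p x) \<in> homogeneous_polynomials (Suc (Suc m))"
proof -
  have "(\<lambda>x. \<Sum>b\<in>Basis. inner x b * (inner x b * p x)) \<in> homogeneous_polynomials (Suc (Suc m))"
    by (intro homogeneous_polynomials_sum homogeneous_polynomials_coord_mult assms)
  moreover have "(\<lambda>x. \<Sum>b\<in>Basis. inner x b * (inner x b * p x)) = (\<lambda>x. inner x x * p x)"
    unfolding fun_eq_iff by (subst (3) euclidean_inner) (simp add: sum_distrib_right mult.assoc)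
  ultimately show ?thesis by simp
qed

lemma homogeneous_polynomials_norm_power_mult:
  fixes p :: "'a::euclidean_space \<Rightarrow> real"
  assumes "p \<in> homogeneous_polynomials m"
  shows "(\<lambda>x. inner x x ^ i * p x) \<in> homogeneous_polynomials (m + 2 * i)"
proof (induction i)
  case (Suc i)
  from homogeneous_polynomials_norm_mult[OF this] show ?case by (simp add: mult.assoc)
qed (use assms in simp)

section \<open>Derivatives and the Laplacian\<close>

text \<open>
  The derivative along a line, which is the form in which \<open>laplacian\<close> refers to derivatives.
\<close>

definition partial_deriv :: "'a::euclidean_space \<Rightarrow> ('a \<Rightarrow> real) \<Rightarrow> 'a \<Rightarrow> real" where
  "partial_deriv b p x = deriv (\<lambda>s. p (x + s *\<^sub>R b)) 0"

lemma partial_deriv_eqI: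
  "((\<lambda>s. p (x + s *\<^sub>R b)) has_real_derivative D) (at 0) \<Longrightarrow> partial_deriv b p x = D"
  unfolding partial_deriv_def by (rule DERIV_imp_deriv)

lemma has_derivative_monomial:
  fixes b :: "'a::euclidean_space"
  assumes b: "b \<in> Basis"
  shows "((\<lambda>s. monomial \<alpha> (x + s *\<^sub>R b)) has_real_derivative
    real (\<alpha> b) * monomial (\<alpha>(b := \<alpha> b - 1)) x) (at 0)"
proof -
  have "monomial \<alpha> (x + s *\<^sub>R b) = (inner x b + s) ^ \<alpha> b * (\<Prod>a\<in>Basis - {b}. inner x a ^ \<alpha> a)" for s
  proof -
    have "monomial \<alpha> (x + s *\<^sub>R b) =
        inner (x + s *\<^sub>R b) b ^ \<alpha> b * (\<Prod>a\<in>Basis - {b}. inner (x + s *\<^sub>R b) a ^ \<alpha> a)"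
      using monomial_fun_upd[OF b, of \<alpha> "\<alpha> b" "x + s *\<^sub>R b"] by simp
    also have "(\<Prod>a\<in>Basis - {b}. inner (x + s *\<^sub>R b) a ^ \<alpha> a) = (\<Prod>a\<in>Basis - {b}. inner x a ^ \<alpha> a)"
      using b by (intro prod.cong) (auto simp: inner_add_left inner_Basis)
    finally show ?thesis using b by (simp add: inner_add_left inner_Basis)
  qed
  moreover have "((\<lambda>s. (inner x b + s) ^ \<alpha> b * (\<Prod>a\<in>Basis - {b}. inner x a ^ \<alpha> a)) has_real_derivative
      real (\<alpha> b) * monomial (\<alpha>(b := \<alpha> b - 1)) x) (at 0)"
    unfolding monomial_fun_upd[OF b] by (auto intro!: derivative_eq_intros)
  ultimately show ?thesis by (simp only:)
qed

lemma homogeneous_polynomials_partial_deriv: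
  fixes b :: "'a::euclidean_space"
  assumes b: "b \<in> Basis" and p: "p \<in> homogeneous_polynomials m"
  shows "((\<lambda>s. p (x + s *\<^sub>R b)) has_real_derivative partial_deriv b p x) (at 0)" (is "?A p x")
    and "partial_deriv b p \<in> homogeneous_polynomials (m - 1)"
proof -
  have "(\<forall>x. ?A p x) \<and> partial_deriv b p \<in> homogeneous_polynomials (m - 1)"
    using p
  proof (induction rule: homogeneous_polynomials_induct)
    case zero
    have "((\<lambda>s. 0) has_real_derivative 0) (at 0)" by simp
    moreover from this have "partial_deriv b (\<lambda>_. 0) = (\<lambda>_. 0)"
      by (intro ext partial_deriv_eqI)
    ultimately show ?case by (simp add: homogeneous_polynomials_zero)
  next
    case (step c \<alpha> p)
    let ?q = "\<lambda>x. c * real (\<alpha> b) * monomial (\<alpha>(b := \<alpha> b - 1)) x + partial_deriv b p x"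
    have D: "((\<lambda>s. c * monomial \<alpha> (x + s *\<^sub>R b) + p (x + s *\<^sub>R b)) has_real_derivative ?q x) (at 0)" for x
      using step(3) by (auto intro!: derivative_eq_intros has_derivative_monomial[OF b])
    then have eq: "partial_deriv b (\<lambda>x. c * monomial \<alpha> x + p x) = ?q"
      by (intro ext partial_deriv_eqI)
    have "?q \<in> homogeneous_polynomials (m - 1)"
    proof (cases "\<alpha> b = 0")
      case True
      with step show ?thesis by simp
    next
      case False
      then have "monomial_degree (\<alpha>(b := \<alpha> b - 1)) = m - 1"
        using monomial_degree_fun_upd[OF b, of \<alpha> "\<alpha> b - 1"] step(1) by simp
      then show ?thesis using step by (intro homogeneous_polynomials_step) auto
    qed
    with D eq show ?case by simp
  qed
  then show "?A p x" "partial_deriv b p \<in> homogeneous_polynomials (m - 1)" by auto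
qed

lemma Euler_homogeneous:
  fixes p :: "'a::euclidean_space \<Rightarrow> real"
  assumes p: "p \<in> homogeneous_polynomials m"
  shows "(\<Sum>b\<in>Basis. inner x b * partial_deriv b p x) = real m * p x"
  using p
proof (induction rule: homogeneous_polynomials_induct)
  case zero
  have "partial_deriv b (\<lambda>_::'a. 0) x = 0" for b
    by (rule partial_deriv_eqI) simp
  then show ?case by simp
next
  case (step c \<alpha> p)
  have "inner x b * partial_deriv b (\<lambda>x. c * monomial \<alpha> x + p x) x =
      c * (real (\<alpha> b) * monomial \<alpha> x) + inner x b * partial_deriv b p x" if b: "b \<in> Basis" for b
  proof -
    have "partial_deriv b (\<lambda>x. c * monomial \<alpha> x + p x) x =
        c * (real (\<alpha> b) * monomial (\<alpha>(b := \<alpha> b - 1)) x) + partial_deriv b p x"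
      by (rule partial_deriv_eqI)
         (auto intro!: derivative_eq_intros has_derivative_monomial[OF b]
            homogeneous_polynomials_partial_deriv(1)[OF b step(2)])
    moreover have "real (\<alpha> b) * (inner x b * monomial (\<alpha>(b := \<alpha> b - 1)) x) = real (\<alpha> b) * monomial \<alpha> x"
      using monomial_fun_upd[OF b, of \<alpha> "\<alpha> b" x, unfolded fun_upd_triv]
        monomial_fun_upd[OF b, of \<alpha> "\<alpha> b - 1" x]
      by (cases "\<alpha> b = 0") (simp_all add: power_eq_if)
    ultimately show ?thesis by (simp add: algebra_simps)
  qed
  then have "(\<Sum>b\<in>Basis. inner x b * partial_deriv b (\<lambda>x. c * monomial \<alpha> x + p x) x) =
     c * ((\<Sum>b\<in>Basis. real (\<alpha> b)) * monomial \<alpha> x) + real m * p x"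
    using step(3) by (simp add: sum.distrib sum_distrib_left sum_distrib_right)
  also have "(\<Sum>b\<in>Basis. real (\<alpha> b)) = real m"
    using step(1) by (simp add: monomial_degree_def flip: of_nat_sum)
  finally show ?case by (simp add: algebra_simps)
qed

lemma laplacian_homogeneous:
  fixes p :: "'a::euclidean_space \<Rightarrow> real"
  assumes p: "p \<in> homogeneous_polynomials m"
  shows "laplacian p x = (\<Sum>b\<in>Basis. partial_deriv b (partial_deriv b p) x)"
proof -
  have "deriv (deriv (\<lambda>s. p (x + s *\<^sub>R b))) 0 = partial_deriv b (partial_deriv b p) x"
    if b: "b \<in> Basis" for b
  proof -
    have "deriv (\<lambda>s. p (x + s *\<^sub>R b)) s = partial_deriv b p (x + s *\<^sub>R b)" for s
    proof -
      have "((\<lambda>h. p ((x + s *\<^sub>R b) + h *\<^sub>R b)) has_real_derivative partial_deriv b p (x + s *\<^sub>R b)) (at 0)"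
        by (rule homogeneous_polynomials_partial_deriv(1)[OF b p])
      then have "((\<lambda>h. p (x + (h + s) *\<^sub>R b)) has_real_derivative partial_deriv b p (x + s *\<^sub>R b)) (at 0)"
        by (simp add: algebra_simps)
      then show ?thesis
        using DERIV_shift[of "\<lambda>h. p (x + h *\<^sub>R b)" _ 0 s] by (intro DERIV_imp_deriv) simp
    qed
    then have "deriv (\<lambda>s. p (x + s *\<^sub>R b)) = (\<lambda>s. partial_deriv b p (x + s *\<^sub>R b))" by blast
    then show ?thesis by (simp only: partial_deriv_def[of b "partial_deriv b p"])
  qed
  then show ?thesis by (simp add: laplacian_def eval_nat_numeral)
qed

lemma partial_deriv_lincomb:
  fixes b :: "'a::euclidean_space"
  assumes b: "b \<in> Basis" and "p \<in> homogeneous_polynomials m" "q \<in> homogeneous_polynomials n"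
  shows "partial_deriv b (\<lambda>x. u * p x + v * q x) = (\<lambda>x. u * partial_deriv b p x + v * partial_deriv b q x)"
  by (intro ext partial_deriv_eqI)
     (auto intro!: derivative_eq_intros homogeneous_polynomials_partial_deriv(1)[OF b assms(2)]
        homogeneous_polynomials_partial_deriv(1)[OF b assms(3)])

lemma laplacian_lincomb:
  fixes p q :: "'a::euclidean_space \<Rightarrow> real"
  assumes p: "p \<in> homogeneous_polynomials m" and q: "q \<in> homogeneous_polynomials m"
  shows "laplacian (\<lambda>x. u * p x + v * q x) x = u * laplacian p x + v * laplacian q x"
proof -
  have "laplacian (\<lambda>x. u * p x + v * q x) x =
      (\<Sum>b\<in>Basis. partial_deriv b (partial_deriv b (\<lambda>x. u * p x + v * q x)) x)"
    by (intro laplacian_homogeneous[of _ m] homogeneous_polynomials_add homogeneous_polynomials_cmult p q)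
  also have "\<dots> = (\<Sum>b\<in>Basis. u * partial_deriv b (partial_deriv b p) x + v * partial_deriv b (partial_deriv b q) x)"
    by (intro sum.cong refl)
       (simp add: partial_deriv_lincomb[OF _ p q]
          partial_deriv_lincomb[OF _ homogeneous_polynomials_partial_deriv(2)[OF _ p]
             homogeneous_polynomials_partial_deriv(2)[OF _ q]])
  finally show ?thesis
    by (simp add: laplacian_homogeneous[OF p] laplacian_homogeneous[OF q] sum.distrib sum_distrib_left)
qed

lemma laplacian_homogeneous_polynomials:
  fixes p :: "'a::euclidean_space \<Rightarrow> real"
  assumes p: "p \<in> homogeneous_polynomials m"
  shows "laplacian p \<in> homogeneous_polynomials (m - 2)"
proof -
  have "laplacian p = (\<lambda>x. \<Sum>b\<in>Basis. partial_deriv b (partial_deriv b p) x)"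
    using laplacian_homogeneous[OF p] by blast
  also have "\<dots> \<in> homogeneous_polynomials (m - 1 - 1)"
    by (intro homogeneous_polynomials_sum homogeneous_polynomials_partial_deriv(2) p)
  finally show ?thesis by (simp add: numeral_2_eq_2)
qed

lemma laplacian_low_degree:
  fixes p :: "'a::euclidean_space \<Rightarrow> real"
  assumes p: "p \<in> homogeneous_polynomials m" and m: "m < 2"
  shows "laplacian p x = 0"
proof -
  have const: "partial_deriv b q y = 0" if q: "q \<in> homogeneous_polynomials 0" for b y and q :: "'a \<Rightarrow> real"
  proof (rule partial_deriv_eqI)
    have "q z = q 0" for z using homogeneous_polynomials_scaleR[OF q, of 0 z] by simp
    then have "(\<lambda>s. q (y + s *\<^sub>R b)) = (\<lambda>s. q 0)" by blast
    then show "((\<lambda>s. q (y + s *\<^sub>R b)) has_real_derivative 0) (at 0)" by simp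
  qed
  have "partial_deriv b p \<in> homogeneous_polynomials 0" if "b \<in> Basis" for b
    using homogeneous_polynomials_partial_deriv(2)[OF that p] m by simp
  then show ?thesis
    unfolding laplacian_homogeneous[OF p] by (intro sum.neutral) (simp add: const)
qed

text \<open>
  The product rule gives a mixed term that is four times the Euler derivative of \<open>p\<close>, that is,
  \<open>4 m p\<close>; the term \<open>2 DIM('a) p\<close> is \<open>p\<close> times the Laplacian of \<open>\<bar>x\<bar>\<^sup>2\<close>.
\<close>

lemma laplacian_norm_mult:
  fixes p :: "'a::euclidean_space \<Rightarrow> real"
  assumes p: "p \<in> homogeneous_polynomials m"
  shows "laplacian (\<lambda>x. inner x x * p x) x = (2 * DIM('a) + 4 * m) * p x + inner x x * laplacian p x"
proof -
  have "partial_deriv b (partial_deriv b (\<lambda>x. inner x x * p x)) x =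
      2 * p x + 4 * (inner x b * partial_deriv b p x) + inner x x * partial_deriv b (partial_deriv b p) x"
    if b: "b \<in> Basis" for b
  proof -
    note D = homogeneous_polynomials_partial_deriv[OF b p]
    have N: "((\<lambda>s. inner (x + s *\<^sub>R b) (x + s *\<^sub>R b)) has_real_derivative 2 * inner x b) (at 0)" for x
    proof -
      have "inner (x + s *\<^sub>R b) (x + s *\<^sub>R b) = inner x x + 2 * s * inner x b + s\<^sup>2" for s
        using b by (simp add: inner_add_left inner_add_right inner_commute[of b x] inner_Basis power2_eq_square algebra_simps)
      then show ?thesis by (auto intro!: derivative_eq_intros)
    qed
    have C: "((\<lambda>s. inner (x + s *\<^sub>R b) b) has_real_derivative 1) (at 0)" for x
      using b by (simp add: inner_add_left inner_Basis) (auto intro!: derivative_eq_intros)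
    have 1: "partial_deriv b (\<lambda>x. inner x x * p x) = (\<lambda>x. 2 * inner x b * p x + inner x x * partial_deriv b p x)"
      by (intro ext partial_deriv_eqI) (auto intro!: derivative_eq_intros N D(1))
    show ?thesis unfolding 1
      by (rule partial_deriv_eqI, rule DERIV_cong[OF DERIV_add[OF
            DERIV_mult[OF DERIV_cmult[OF C] D(1)]
            DERIV_mult[OF N homogeneous_polynomials_partial_deriv(1)[OF b D(2)]]]])
         (simp add: inner_commute[of b x] algebra_simps)
  qed
  then have "laplacian (\<lambda>x. inner x x * p x) x =
      2 * DIM('a) * p x + 4 * (\<Sum>b\<in>Basis. inner x b * partial_deriv b p x) +
      inner x x * (\<Sum>b\<in>Basis. partial_deriv b (partial_deriv b p) x)"
    unfolding laplacian_homogeneous[OF homogeneous_polynomials_norm_mult[OF p]]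
    by (simp add: sum.distrib sum_distrib_left)
  then show ?thesis
    unfolding Euler_homogeneous[OF p] laplacian_homogeneous[OF p] by (simp add: algebra_simps)
qed

text \<open>
  Each factor \<open>\<bar>x\<bar>\<^sup>2\<close> contributes a positive multiple of the same function. Positivity of the total is
  what makes it possible to solve the Poisson equation in the space of polynomials.
\<close>

lemma laplacian_norm_power_mult_harmonic:
  fixes h :: "'a::euclidean_space \<Rightarrow> real"
  assumes h: "h \<in> homogeneous_polynomials m" "\<And>x. laplacian h x = 0"
  shows "\<exists>c>0. \<forall>x. laplacian (\<lambda>x. inner x x ^ Suc i * h x) x = c * (inner x x ^ i * h x)"
proof (induction i)
  case 0
  have "2 * real DIM('a) + 4 * real m > 0" by (simp add: add_pos_nonneg)
  with laplacian_norm_mult[OF h(1)] show ?case by (auto simp: h(2))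
next
  case (Suc i)
  then obtain c where c: "c > 0"
    "\<And>x. laplacian (\<lambda>x. inner x x ^ Suc i * h x) x = c * (inner x x ^ i * h x)" by blast
  let ?c = "real (2 * DIM('a) + 4 * (m + 2 * Suc i)) + c"
  have "laplacian (\<lambda>x. inner x x ^ Suc (Suc i) * h x) x = ?c * (inner x x ^ Suc i * h x)" for x
    using laplacian_norm_mult[OF homogeneous_polynomials_norm_power_mult[OF h(1), of "Suc i"], of x] c(2)
    by (simp add: algebra_simps)
  moreover have "?c > 0" using c(1) by (simp add: add_nonneg_pos)
  ultimately show ?case by blast
qed

section \<open>Decomposition into harmonic polynomials\<close>

text \<open>
  By induction on the degree, the Laplacian of \<open>p\<close> is a sum of terms \<open>\<bar>x\<bar>\<^bsup>2i\<^esup> g\<^sub>i\<close> with \<open>g\<^sub>i\<close> harmonic. Each of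
  them is the Laplacian of a multiple of \<open>\<bar>x\<bar>\<^bsup>2i+2\<^esup> g\<^sub>i\<close>, and subtracting these multiples from \<open>p\<close> leaves a
  harmonic polynomial.
\<close>

theorem harmonic_decomposition:
  fixes p :: "'a::euclidean_space \<Rightarrow> real"
  assumes "p \<in> homogeneous_polynomials m"
  shows "\<exists>h. (\<forall>i\<le>m div 2. h i \<in> homogeneous_polynomials (m - 2 * i) \<and> (\<forall>x. laplacian (h i) x = 0)) \<and>
             (\<forall>x. p x = (\<Sum>i\<le>m div 2. inner x x ^ i * h i x))"
  using assms
proof (induction m arbitrary: p rule: less_induct)
  case (less m)
  show ?case
  proof (cases "m < 2")
    case True
    with laplacian_low_degree[OF less.prems] less.prems show ?thesis
      by (intro exI[of _ "\<lambda>_. p"]) auto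
  next
    case False
    define n where "n = m - 2"
    have m: "m = Suc (Suc n)" and mdiv: "m div 2 = Suc (n div 2)" using False by (auto simp: n_def)
    obtain g where g: "\<And>i. i \<le> n div 2 \<Longrightarrow> g i \<in> homogeneous_polynomials (n - 2 * i)"
        "\<And>i x. i \<le> n div 2 \<Longrightarrow> laplacian (g i) x = 0"
      and lap: "\<And>x. laplacian p x = (\<Sum>i\<le>n div 2. inner x x ^ i * g i x)"
      using less.IH[of n "laplacian p"] laplacian_homogeneous_polynomials[OF less.prems] m by auto
    have "\<forall>i\<in>{..n div 2}. \<exists>c>0. \<forall>x. laplacian (\<lambda>x. inner x x ^ Suc i * g i x) x = c * (inner x x ^ i * g i x)"
      using laplacian_norm_power_mult_harmonic g by blast
    then obtain c where c: "\<And>i. i \<le> n div 2 \<Longrightarrow> c i > 0"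
      "\<And>i x. i \<le> n div 2 \<Longrightarrow> laplacian (\<lambda>x. inner x x ^ Suc i * g i x) x = c i * (inner x x ^ i * g i x)"
      by (subst (asm) bchoice_iff) auto
    \<comment> \<open>The Laplacians of the \<open>q i\<close> are the summands of the Laplacian of \<open>p\<close>.\<close>
    define q where "q i x = inner x x ^ Suc i * g i x / c i" for i x
    have qhom: "(\<lambda>x. inner x x ^ Suc i * g i x) \<in> homogeneous_polynomials m" if "i \<le> n div 2" for i
    proof -
      have "n - 2 * i + 2 * Suc i = m" using that m by auto
      then show ?thesis using homogeneous_polynomials_norm_power_mult[OF g(1)[OF that], of "Suc i"] by simp
    qed
    have q: "q i \<in> homogeneous_polynomials m" "laplacian (q i) x = inner x x ^ i * g i x"
      if "i \<le> n div 2" for i x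
    proof -
      \<comment> \<open>The summand with factor 0 gives the function the shape that \<open>laplacian_lincomb\<close> expects.\<close>
      have eq: "q i = (\<lambda>x. (1 / c i) * (inner x x ^ Suc i * g i x) + 0 * (inner x x ^ Suc i * g i x))"
        by (auto simp: q_def)
      show "q i \<in> homogeneous_polynomials m" unfolding eq
        using homogeneous_polynomials_cmult[OF qhom[OF that], of "1 / c i"] by simp
      show "laplacian (q i) x = inner x x ^ i * g i x"
        unfolding eq laplacian_lincomb[OF qhom qhom, OF that that] c(2)[OF that]
        using c(1)[OF that] by simp
    qed
    have sum: "(\<lambda>x. \<Sum>i\<in>I. q i x) \<in> homogeneous_polynomials m \<and>
        (\<forall>x. laplacian (\<lambda>x. \<Sum>i\<in>I. q i x) x = (\<Sum>i\<in>I. laplacian (q i) x))"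
      if "finite I" "I \<subseteq> {..n div 2}" for I
      using that
    proof (induction I rule: finite_induct)
      case empty
      have "laplacian (\<lambda>_::'a. 0) x = 0" for x
        by (rule laplacian_low_degree[of _ 0]) (auto intro: homogeneous_polynomials_zero)
      then show ?case by (simp add: homogeneous_polynomials_zero)
    next
      case (insert i I)
      then show ?case
        using laplacian_lincomb[of "q i" m "\<lambda>x. \<Sum>i\<in>I. q i x" 1 1]
          homogeneous_polynomials_add[of "q i" m "\<lambda>x. \<Sum>i\<in>I. q i x"] q(1)[of i]
        by simp
    qed
    define h0 where "h0 x = 1 * p x + (-1) * (\<Sum>i\<le>n div 2. q i x)" for x
    have S: "(\<lambda>x. \<Sum>i\<le>n div 2. q i x) \<in> homogeneous_polynomials m"
      "\<And>x. laplacian (\<lambda>x. \<Sum>i\<le>n div 2. q i x) x = laplacian p x"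
      using sum[of "{..n div 2}"] q(2) lap by auto
    have h0: "h0 \<in> homogeneous_polynomials m" "laplacian h0 x = 0" for x
    proof -
      show "h0 \<in> homogeneous_polynomials m" unfolding h0_def
        by (intro homogeneous_polynomials_add homogeneous_polynomials_cmult S less.prems)
      show "laplacian h0 x = 0"
        unfolding h0_def laplacian_lincomb[OF less.prems S(1)] S(2) by simp
    qed
    define h where "h i = (case i of 0 \<Rightarrow> h0 | Suc i \<Rightarrow> (\<lambda>x. (1 / c i) * g i x + 0 * g i x))" for i
    have "h i \<in> homogeneous_polynomials (m - 2 * i) \<and> (\<forall>x. laplacian (h i) x = 0)" if "i \<le> m div 2" for i
    proof (cases i)
      case (Suc j)
      then have j: "j \<le> n div 2" using that mdiv by simp
      have "laplacian (\<lambda>x. (1 / c j) * g j x + 0 * g j x) x = 0" for x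
        unfolding laplacian_lincomb[OF g(1) g(1), OF j j] g(2)[OF j] by simp
      then show ?thesis
        using homogeneous_polynomials_cmult[OF g(1)[OF j], of "1 / c j"] Suc m by (simp add: h_def)
    qed (use h0 in \<open>simp add: h_def\<close>)
    moreover have "p x = (\<Sum>i\<le>m div 2. inner x x ^ i * h i x)" for x
      unfolding mdiv sum.atMost_Suc_shift by (simp add: h_def h0_def q_def)
    ultimately show ?thesis by blast
  qed
qed

section \<open>The surface measure and homogeneous functions\<close>

lemma integral_scale_measure:
  fixes f :: "'a \<Rightarrow> real"
  assumes f: "f \<in> borel_measurable M" and c: "c \<ge> 0"
  shows "(LINT x|scale_measure (ennreal c) M. f x) = c * (LINT x|M. f x)"
proof -
  have "scale_measure (ennreal c) M = density M (\<lambda>_. ennreal c)"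
    by (rule measure_eqI) (auto simp: emeasure_density_const)
  then show ?thesis using assms by (simp add: integral_density)
qed

lemma sets_surface_measure [simp, measurable_cong]: "sets surface_measure = sets borel"
  by (simp add: surface_measure_def)

lemma space_surface_measure [simp]: "space surface_measure = UNIV"
  by (simp add: surface_measure_def space_scale_measure)

lemma integral_surface_measure:
  fixes f :: "'a::euclidean_space \<Rightarrow> real"
  assumes [measurable]: "f \<in> borel_measurable borel"
  shows "(LINT x|surface_measure. f x) = DIM('a) * (LINT x:cball 0 1 - {0}|lborel. f (sgn x))"
proof -
  let ?R = "restrict_space lborel (cball 0 1 - {0}) :: 'a measure"
  have "(LINT x|surface_measure. f x) = DIM('a) * (LINT x|distr ?R borel sgn. f x)"
    unfolding surface_measure_def ennreal_of_nat_eq_real_of_nat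
    by (rule integral_scale_measure) auto
  also have "(LINT x|distr ?R borel sgn. f x) = (LINT x|?R. f (sgn x))"
    by (rule integral_distr) auto
  also have "\<dots> = (LINT x:cball 0 1 - {0}|lborel. f (sgn x))"
    unfolding set_lebesgue_integral_def by (rule integral_restrict_space) auto
  finally show ?thesis .
qed

lemma finite_measure_surface_measure: "finite_measure (surface_measure :: 'a::euclidean_space measure)"
proof
  let ?R = "restrict_space lborel (cball 0 1 - {0}) :: 'a measure"
  have "emeasure ?R (space ?R) = emeasure lborel (cball 0 1 - {0} :: 'a set)"
    by (subst emeasure_restrict_space) (auto simp: space_restrict_space)
  also have "\<dots> < \<infinity>" by (intro emeasure_bounded_finite bounded_diff) simp
  finally have "emeasure ?R (space ?R) < \<infinity>" .
  moreover have "emeasure (surface_measure :: 'a measure) UNIV = of_nat DIM('a) * emeasure ?R (space ?R)"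
    unfolding surface_measure_def emeasure_scale_measure
    by (subst emeasure_distr[OF measurable_sgn_restrict]) auto
  ultimately show "emeasure (surface_measure :: 'a measure) (space surface_measure) \<noteq> \<infinity>"
    by (simp add: ennreal_mult_eq_top_iff less_top)
qed

lemma set_integrable_surface_measure:
  fixes f :: "'a::euclidean_space \<Rightarrow> real"
  assumes "continuous_on UNIV f" and "closed A" and "A \<subseteq> sphere 0 1"
  shows "set_integrable surface_measure A f"
proof -
  have "compact (sphere (0::'a) 1)" by simp
  then obtain M where M: "\<And>x. x \<in> sphere 0 1 \<Longrightarrow> \<bar>f x\<bar> \<le> M"
    using continuous_on_subset[OF assms(1) subset_UNIV] compact_imp_bounded[OF compact_continuous_image]
    by (metis bounded_real image_eqI)
  then have M: "\<bar>f x\<bar> \<le> max M 0" if "x \<in> A" for x using that assms(3) by force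
  have [measurable]: "f \<in> borel_measurable borel" "A \<in> sets borel"
    using assms by (auto intro: borel_measurable_continuous_onI)
  interpret finite_measure "surface_measure :: 'a measure" by (rule finite_measure_surface_measure)
  show ?thesis unfolding set_integrable_def
    by (rule integrable_const_bound[of _ "max M 0"]) (auto simp: indicator_def M)
qed

lemma lborel_integral_scaleR:
  fixes f :: "'a::euclidean_space \<Rightarrow> real"
  assumes [measurable]: "f \<in> borel_measurable borel" and c: "c > 0"
  shows "(LINT x|lborel. f x) = c ^ DIM('a) * (LINT x|lborel. f (c *\<^sub>R x))"
proof -
  have "(LINT x|lborel. f x) =
      (LINT x|density (distr lborel borel (\<lambda>x. 0 + c *\<^sub>R x)) (\<lambda>_. ennreal (\<bar>c\<bar> ^ DIM('a))). f x)"
    using lborel_affine[of c "0::'a"] c by (simp add: ennreal_power)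
  also have "\<dots> = c ^ DIM('a) * (LINT x|distr lborel borel (\<lambda>x. 0 + c *\<^sub>R x). f x)"
    using c by (subst integral_density) auto
  also have "(LINT x|distr lborel borel (\<lambda>x. 0 + c *\<^sub>R x). f x) = (LINT x|lborel. f (c *\<^sub>R x))"
    by (subst integral_distr) auto
  finally show ?thesis .
qed

lemma integral_power_unit:
  "(LINT x:{0..1}|lborel. real n * x ^ (n - 1)) = (if n = 0 then 0 else 1)"
proof -
  have "((\<lambda>x. real n * x ^ (n - 1)) has_integral (1 ^ n - 0 ^ n)) {0..1::real}"
    by (intro fundamental_theorem_of_calculus)
       (auto intro!: derivative_eq_intros simp flip: has_real_derivative_iff_has_vector_derivative)
  then have "integral {0..1} (\<lambda>x. real n * x ^ (n - 1)) = 1 ^ n - 0 ^ n"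
    by (rule integral_unique)
  also have "(1::real) ^ n - 0 ^ n = (if n = 0 then 0 else 1)" by simp
  moreover have "set_integrable lborel {0..1} (\<lambda>x. real n * x ^ (n - 1))"
    by (intro borel_integrable_atLeastAtMost' continuous_intros)
  ultimately show ?thesis by (simp only: set_borel_integral_eq_integral(2))
qed

text \<open>
  Polar coordinates, in the only form that is needed. The surface integral of \<open>f\<close> is by definition
  \<open>DIM('a)\<close> times the ball integral of \<open>f (sgn x)\<close>, whereas \<open>f x\<close> carries in addition the factor
  \<open>\<bar>x\<bar>\<^sup>r\<close>. Writing \<open>1 - \<bar>x\<bar>\<^sup>r\<close> as the integral of \<open>r \<rho>\<^bsup>r-1\<^esup>\<close> over \<open>[\<bar>x\<bar>, 1]\<close> and exchanging the integrals
  leaves integrals of \<open>f (sgn x)\<close> over balls of radius \<open>\<rho>\<close>, which scale like \<open>\<rho>\<close> to the power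
  \<open>DIM('a)\<close>.
\<close>

lemma sphere_integral_homogeneous:
  fixes f :: "'a::euclidean_space \<Rightarrow> real"
  assumes f [measurable]: "f \<in> borel_measurable borel"
    and hom: "\<And>c x. c > 0 \<Longrightarrow> f (c *\<^sub>R x) = c ^ r * f x"
    and bound: "\<And>x. x \<in> sphere 0 1 \<Longrightarrow> \<bar>f x\<bar> \<le> M"
  shows "(LINT x:sphere 0 1|surface_measure. f x) = (DIM('a) + r) * (LINT x:cball 0 1|lborel. f x)"
proof -
  let ?N = "DIM('a)"
  define G where "G x = indicator (cball 0 1 - {0}) x * f (sgn x)" for x :: 'a
  define J where "J = (LINT x|lborel. G x)"
  have sgn_m [measurable]: "sgn \<in> borel_measurable (borel :: 'a measure)"
  proof -
    have "(\<lambda>x::'a. x /\<^sub>R norm x) \<in> borel_measurable borel" by measurable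
    then show ?thesis by (simp add: sgn_div_norm[abs_def])
  qed
  have cball_m [measurable]: "cball (0::'a) 1 \<in> sets borel" by simp
  have G_m [measurable]: "G \<in> borel_measurable borel" 
    unfolding G_def by (intro borel_measurable_times borel_measurable_indicator measurable_compose[OF sgn_m f]) auto
  have M0: "M \<ge> 0" using bound[of "SOME b. b \<in> Basis"] some_in_eq[of "Basis :: 'a set"]
    by (smt (verit) nonempty_Basis norm_Basis mem_sphere dist_0_norm)
  have G_bound: "\<bar>G x\<bar> \<le> M" for x
    using bound[of "sgn x"] M0 by (auto simp: G_def indicator_def norm_sgn)
  have G_zero: "G x = 0" if "x \<notin> cball 0 1" for x using that by (simp add: G_def)
  have fin: "emeasure lborel (cball (0::'a) 1) < \<infinity>" by (intro emeasure_bounded_finite) simp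
  have G_int: "integrable lborel G"
    by (rule integrableI_bounded_set[where A="cball 0 1" and B=M]) (use fin G_bound G_zero in auto)
  have GJ: "(LINT x:sphere 0 1|surface_measure. f x) = ?N * J"
  proof -
    have "(LINT x:sphere 0 1|surface_measure. f x) =
        ?N * (LINT x:cball 0 1 - {0}|lborel. indicator (sphere 0 1) (sgn x) *\<^sub>R f (sgn x))"
      unfolding set_lebesgue_integral_def[of surface_measure]
      by (rule integral_surface_measure, intro borel_measurable_scaleR borel_measurable_indicator f) auto
    also have "(LINT x:cball 0 1 - {0}|lborel. indicator (sphere 0 1) (sgn x) *\<^sub>R f (sgn x)) = J"
      unfolding J_def set_lebesgue_integral_def G_def
      by (intro Bochner_Integration.integral_cong) (auto simp: indicator_def norm_sgn)
    finally show ?thesis .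
  qed
  have fG: "(LINT x:cball 0 1|lborel. f x) = (LINT x|lborel. norm x ^ r * G x)"
    unfolding set_lebesgue_integral_def
  proof (rule integral_cong_AE)
    show "AE x in lborel. indicator (cball 0 1) x *\<^sub>R f x = norm x ^ r * G x"
    proof (rule AE_mp[OF AE_lborel_singleton[of "0::'a"]], rule AE_I2, rule impI)
      fix x :: 'a assume x: "x \<noteq> 0"
      then have "f x = norm x ^ r * f (sgn x)"
        using hom[of "norm x" "sgn x"] by (simp add: sgn_div_norm)
      with x show "indicator (cball 0 1) x *\<^sub>R f x = norm x ^ r * G x"
        by (simp add: G_def indicator_def)
    qed
  qed auto
  have nG_int: "integrable lborel (\<lambda>x. norm x ^ r * G x)"
  proof (rule Bochner_Integration.integrable_bound[OF G_int])
    show "AE x in lborel. norm (norm x ^ r * G x) \<le> norm (G x)"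
    proof (rule AE_I2)
      fix x :: 'a
      show "norm (norm x ^ r * G x) \<le> norm (G x)"
        using G_zero[of x] power_le_one[of "norm x" r]
        by (cases "norm x \<le> 1") (auto simp: abs_mult intro: mult_left_le_one_le)
    qed
  qed measurable
  \<comment> \<open>The indicator of \<open>{0..}\<close> at \<open>\<rho> - norm x\<close> restricts \<open>x\<close> to the ball of radius \<open>\<rho>\<close>, and \<open>\<rho>\<close> to \<open>[norm x, 1]\<close>.\<close>
  define K where "K \<rho> x = indicator {0..1} \<rho> * (r * \<rho> ^ (r - 1)) * (indicator {0..} (\<rho> - norm x) * G x)"
    for \<rho> :: real and x
  have K_int: "integrable (lborel \<Otimes>\<^sub>M lborel) (case_prod K)"
  proof (rule integrableI_bounded_set[where A="{0..1} \<times> cball 0 1" and B="r * M"])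
    show "emeasure (lborel \<Otimes>\<^sub>M lborel) ({0..1::real} \<times> cball (0::'a) 1) < \<infinity>"
      unfolding lborel_prod by (intro emeasure_bounded_finite bounded_Times) auto
    show "AE x\<in>{0..1} \<times> cball 0 1 in lborel \<Otimes>\<^sub>M lborel. norm (case_prod K x) \<le> real r * M"
    proof (rule AE_I2, rule impI)
      fix z :: "real \<times> 'a" assume "z \<in> {0..1} \<times> cball 0 1"
      then obtain \<rho> x where z: "z = (\<rho>, x)" "\<rho> \<in> {0..1}" by auto
      have "\<bar>K \<rho> x\<bar> = (r * \<rho> ^ (r - 1)) * \<bar>indicator {0..} (\<rho> - norm x) * G x\<bar>"
        using z by (simp add: K_def abs_mult)
      also have "\<dots> \<le> r * M"
      proof (rule mult_mono)
        show "r * \<rho> ^ (r - 1) \<le> r"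
          using z power_le_one[of \<rho> "r - 1"] by (auto intro!: mult_left_le)
        show "\<bar>indicator {0..} (\<rho> - norm x) * G x\<bar> \<le> M"
          using G_bound[of x] M0 by (auto simp: indicator_def)
      qed (use M0 in auto)
      finally show "norm (case_prod K z) \<le> r * M" using z by simp
    qed
  qed (auto simp: K_def G_zero case_prod_unfold)
  have scale: "(LINT x|lborel. indicator {0..} (\<rho> - norm x) * G x) = \<rho> ^ ?N * J" if \<rho>: "0 < \<rho>" "\<rho> \<le> 1" for \<rho>
  proof -
    have "(LINT x|lborel. indicator {0..} (\<rho> - norm x) * G x) =
        \<rho> ^ ?N * (LINT x|lborel. indicator {0..} (\<rho> - norm (\<rho> *\<^sub>R x)) * G (\<rho> *\<^sub>R x))"
      by (rule lborel_integral_scaleR) (use \<rho> in auto)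
    also have "(\<lambda>x. indicator {0..} (\<rho> - norm (\<rho> *\<^sub>R x)) * G (\<rho> *\<^sub>R x)) = G"
    proof
      fix x :: 'a
      have "norm (\<rho> *\<^sub>R x) \<le> 1" if "norm x \<le> 1"
        using mult_mono[of \<rho> 1 "norm x" 1] \<rho> that by simp
      moreover have "\<rho> - norm (\<rho> *\<^sub>R x) \<ge> 0 \<longleftrightarrow> norm x \<le> 1"
        using \<rho> by simp
      ultimately show "indicator {0..} (\<rho> - norm (\<rho> *\<^sub>R x)) * G (\<rho> *\<^sub>R x) = G x"
        using \<rho> by (auto simp: G_def indicator_def sgn_scaleR)
    qed
    finally show ?thesis by (simp add: J_def)
  qed
  have "(LINT x|lborel. LINT \<rho>|lborel. K \<rho> x) = (LINT \<rho>|lborel. LINT x|lborel. K \<rho> x)"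
    by (rule lborel_pair.Fubini_integral[OF K_int])
  also have "(LINT \<rho>|lborel. LINT x|lborel. K \<rho> x) = r * J / (?N + r)"
  proof -
    have "(LINT \<rho>|lborel. LINT x|lborel. K \<rho> x) =
        (LINT \<rho>|lborel. (r * J / (?N + r)) * (indicator {0..1} \<rho> *\<^sub>R (real (?N + r) * \<rho> ^ (?N + r - 1))))"
    proof (rule integral_cong_AE)
      show "AE \<rho> in lborel. (LINT x|lborel. K \<rho> x) =
        (r * J / (?N + r)) * (indicator {0..1} \<rho> *\<^sub>R (real (?N + r) * \<rho> ^ (?N + r - 1)))"
      proof (rule AE_mp[OF AE_lborel_singleton[of "0::real"]], rule AE_I2, rule impI)
        fix \<rho> :: real assume "\<rho> \<noteq> 0"
        show "(LINT x|lborel. K \<rho> x) =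
          (r * J / (?N + r)) * (indicator {0..1} \<rho> *\<^sub>R (real (?N + r) * \<rho> ^ (?N + r - 1)))"
        proof (cases "\<rho> \<in> {0..1}")
          case True
          with \<open>\<rho> \<noteq> 0\<close> have \<rho>: "0 < \<rho>" "\<rho> \<le> 1" by auto
          have "(LINT x|lborel. K \<rho> x) = r * \<rho> ^ (r - 1) * (\<rho> ^ ?N * J)"
            unfolding K_def using \<rho> scale[OF \<rho>] by simp
          moreover have "\<rho> ^ (?N + r - 1) = \<rho> ^ (r - 1) * \<rho> ^ ?N" if "r \<noteq> 0"
            using that by (simp flip: power_add add: add.commute)
          ultimately show ?thesis using \<rho> by (cases "r = 0") (auto simp: field_simps)
        qed (simp add: K_def)
      qed
    qed (use lborel.borel_measurable_lebesgue_integral[of "\<lambda>\<rho> x. K \<rho> x" lborel] in \<open>auto simp: K_def case_prod_unfold\<close>)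
    also have "\<dots> = r * J / (?N + r)"
      unfolding integral_mult_right_zero integral_power_unit[unfolded set_lebesgue_integral_def] by simp
    finally show ?thesis .
  qed
  also have "(LINT x|lborel. LINT \<rho>|lborel. K \<rho> x) = (LINT x|lborel. G x - norm x ^ r * G x)"
  proof (rule Bochner_Integration.integral_cong[OF refl])
    fix x :: 'a
    show "(LINT \<rho>|lborel. K \<rho> x) = G x - norm x ^ r * G x"
    proof (cases "norm x \<le> 1")
      case True
      have "(LINT \<rho>|lborel. K \<rho> x) = G x * (LINT \<rho>:{norm x..1}|lborel. r * \<rho> ^ (r - 1))"
        unfolding set_lebesgue_integral_def
        by (subst integral_mult_right_zero[symmetric], rule Bochner_Integration.integral_cong)
           (auto simp: K_def indicator_def; smt (verit) norm_ge_zero)+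
      also have "(LINT \<rho>:{norm x..1}|lborel. r * \<rho> ^ (r - 1)) = integral {norm x..1} (\<lambda>\<rho>. r * \<rho> ^ (r - 1))"
        by (intro set_borel_integral_eq_integral borel_integrable_atLeastAtMost' continuous_intros)
      also have "\<dots> = 1 ^ r - norm x ^ r"
        using True by (intro integral_unique fundamental_theorem_of_calculus)
          (auto intro!: derivative_eq_intros simp flip: has_real_derivative_iff_has_vector_derivative)
      finally show ?thesis by (simp add: algebra_simps)
    qed (simp add: G_zero K_def)
  qed
  also have "\<dots> = J - (LINT x:cball 0 1|lborel. f x)"
    unfolding fG J_def by (rule Bochner_Integration.integral_diff[OF G_int nG_int])
  finally have "J - (LINT x:cball 0 1|lborel. f x) = r * J / (?N + r)" by simp
  moreover have "real ?N + real r > 0" by (simp add: add_pos_nonneg)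
  ultimately show ?thesis unfolding GJ by (simp add: field_simps)
qed

section \<open>Integration over the hemisphere\<close>

lemma norm_Pair_le_one_iff:
  fixes y :: "'a::euclidean_space" and s :: real
  assumes "s \<ge> 0" "s < 1"
  shows "norm (y, s) \<le> 1 \<longleftrightarrow> norm y \<le> sqrt (1 - s\<^sup>2)"
proof -
  have "norm (y, s) \<le> 1 \<longleftrightarrow> (norm y)\<^sup>2 \<le> 1 - s\<^sup>2" by (simp add: norm_Pair) linarith
  also have "\<dots> \<longleftrightarrow> norm y \<le> sqrt (1 - s\<^sup>2)"
    using real_sqrt_le_iff[of "(norm y)\<^sup>2" "1 - s\<^sup>2"] by (simp del: real_sqrt_le_iff)
  finally show ?thesis .
qed

lemma set_integrable_weight:
  fixes q :: "real \<Rightarrow> real"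
  assumes q: "continuous_on UNIV q" and a: "a \<ge> 0"
  shows "set_integrable lborel {0..1} (\<lambda>x. q x * (1 - x\<^sup>2) powr a)"
proof -
  have "set_integrable lborel {0..1} q"
    by (intro borel_integrable_atLeastAtMost' continuous_on_subset[OF q]) simp
  then have "integrable lborel (\<lambda>x. indicator {0..1} x *\<^sub>R q x)"
    by (simp add: set_integrable_def)
  moreover have [measurable]: "q \<in> borel_measurable borel"
    using q by (rule borel_measurable_continuous_onI)
  then have "(\<lambda>x. indicator {0..1} x *\<^sub>R (q x * (1 - x\<^sup>2) powr a)) \<in> borel_measurable lborel"
    by measurable
  moreover have "AE x in lborel. norm (indicator {0..1} x *\<^sub>R (q x * (1 - x\<^sup>2) powr a)) \<le> norm (indicator {0..1} x *\<^sub>R q x)"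
  proof (rule AE_I2)
    fix x :: real
    show "norm (indicator {0..1} x *\<^sub>R (q x * (1 - x\<^sup>2) powr a)) \<le> norm (indicator {0..1} x *\<^sub>R q x)"
    proof (cases "x \<in> {0..1}")
      case True
      then have "x\<^sup>2 \<le> 1" by (simp add: power_le_one)
      then have "(1 - x\<^sup>2) powr a \<le> 1 powr a" using a by (intro powr_mono2) simp_all
      then have "(1 - x\<^sup>2) powr a \<le> 1" by simp
      then have "\<bar>q x\<bar> * (1 - x\<^sup>2) powr a \<le> \<bar>q x\<bar>" by (intro mult_left_le) simp_all
      with True show ?thesis by (simp add: abs_mult)
    qed simp
  qed
  ultimately show ?thesis unfolding set_integrable_def by (rule Bochner_Integration.integrable_bound)
qed

text \<open>
  The slice of the ball at height \<open>s\<close> is a ball of radius \<open>sqrt (1 - s\<^sup>2)\<close>, and \<open>g\<close> scales like a power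
  of the radius.
\<close>

lemma half_ball_integral:
  fixes g :: "'a::euclidean_space \<Rightarrow> real"
  assumes g: "continuous_on UNIV g" and hom: "\<And>c x. c > 0 \<Longrightarrow> g (c *\<^sub>R x) = c ^ m * g x"
  shows "(LINT z:cball 0 1|lborel. g (fst z) * snd z ^ j * indicator {0..} (snd z)) =
    integral {0..1} (\<lambda>s. s ^ j * (1 - s\<^sup>2) powr ((real m + DIM('a)) / 2)) * (LINT y:cball 0 1|lborel. g y)"
proof -
  let ?N = "DIM('a)"
  let ?I = "LINT y:cball 0 1|lborel. g y"
  define K where "K y s = indicator (cball 0 1) (y, s) *\<^sub>R (g y * s ^ j * indicator {0..} s)" for y s
  have gm [measurable]: "g \<in> borel_measurable borel" using g by (rule borel_measurable_continuous_onI)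
  have [measurable]: "fst \<in> borel_measurable (borel :: ('a \<times> real) measure)"
    "snd \<in> borel_measurable (borel :: ('a \<times> real) measure)"
    by (intro borel_measurable_continuous_onI continuous_intros)+
  have [measurable]: "cball (0 :: 'a \<times> real) 1 \<in> sets borel" by simp
  have K: "case_prod K = (\<lambda>z. indicator (cball 0 1) z *\<^sub>R (g (fst z) * snd z ^ j * indicator {0..} (snd z)))"
    by (auto simp: K_def fun_eq_iff)
  have K_int: "integrable (lborel \<Otimes>\<^sub>M lborel) (case_prod K)"
    unfolding lborel_prod
  proof (rule Bochner_Integration.integrable_bound)
    show "integrable lborel (\<lambda>z. indicator (cball 0 1) z *\<^sub>R (g (fst z) * snd z ^ j) :: real)"
      by (intro borel_integrable_compact continuous_intros continuous_on_compose2[OF g]) auto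
    show "case_prod K \<in> borel_measurable lborel"
      unfolding K measurable_lborel1 by measurable
    show "AE z in lborel. norm (case_prod K z) \<le> norm (indicator (cball 0 1) z *\<^sub>R (g (fst z) * snd z ^ j))"
      by (rule AE_I2) (auto simp: K_def indicator_def)
  qed
  have "(LINT z:cball 0 1|lborel. g (fst z) * snd z ^ j * indicator {0..} (snd z)) =
      integral\<^sup>L (lborel \<Otimes>\<^sub>M lborel) (case_prod K)"
    by (simp add: set_lebesgue_integral_def K lborel_prod)
  also have "\<dots> = (LINT s|lborel. LINT y|lborel. K y s)"
    by (rule lborel_pair.integral_snd[OF K_int, symmetric])
  also have "\<dots> = (LINT s|lborel. (indicator {0..1} s *\<^sub>R (s ^ j * (1 - s\<^sup>2) powr ((real m + ?N) / 2))) * ?I)"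
  proof (rule integral_cong_AE)
    \<comment> \<open>At \<open>s = 1\<close> the slice is a single point and the scaling argument does not apply.\<close>
    show "AE s in lborel. (LINT y|lborel. K y s) =
        (indicator {0..1} s *\<^sub>R (s ^ j * (1 - s\<^sup>2) powr ((real m + ?N) / 2))) * ?I"
    proof (rule AE_mp[OF AE_lborel_singleton[of "1::real"]], rule AE_I2, rule impI)
      fix s :: real assume "s \<noteq> 1"
      show "(LINT y|lborel. K y s) =
        (indicator {0..1} s *\<^sub>R (s ^ j * (1 - s\<^sup>2) powr ((real m + ?N) / 2))) * ?I"
      proof (cases "s \<in> {0..1}")
        case True
        with \<open>s \<noteq> 1\<close> have s: "0 \<le> s" "s < 1" by auto
        define R where "R = sqrt (1 - s\<^sup>2)"
        have s2: "s\<^sup>2 < 1" using s by (simp add: abs_square_less_1)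
        then have R: "R > 0" by (simp add: R_def)
        have "K y s = s ^ j * (indicator {..R} (norm y) * g y)" for y
          using norm_Pair_le_one_iff[OF s, of y] s by (simp add: K_def R_def indicator_def)
        then have "(LINT y|lborel. K y s) = s ^ j * (LINT y|lborel. indicator {..R} (norm y) * g y)"
          by (simp only: integral_mult_right_zero)
        also have "(LINT y|lborel. indicator {..R} (norm y) * g y) =
            R ^ ?N * (LINT y|lborel. indicator {..R} (norm (R *\<^sub>R y)) * g (R *\<^sub>R y))"
          by (rule lborel_integral_scaleR) (use R in auto)
        also have "(\<lambda>y. indicator {..R} (norm (R *\<^sub>R y)) * g (R *\<^sub>R y)) =
            (\<lambda>y. R ^ m * (indicator (cball 0 1) y *\<^sub>R g y))"
          using R hom by (auto simp: indicator_def fun_eq_iff)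
        also have "(LINT y|lborel. R ^ m * (indicator (cball 0 1) y *\<^sub>R g y)) = R ^ m * ?I"
          by (simp only: integral_mult_right_zero set_lebesgue_integral_def)
        also have "R ^ ?N * (R ^ m * ?I) = (1 - s\<^sup>2) powr ((real m + ?N) / 2) * ?I"
        proof -
          have "R ^ ?N * R ^ m = R powr real (m + ?N)"
            using R by (subst powr_realpow) (auto simp: power_add)
          also have "\<dots> = (1 - s\<^sup>2) powr ((real m + ?N) / 2)"
            using s2 by (simp add: R_def powr_half_sqrt[symmetric] powr_powr)
          finally show ?thesis by simp
        qed
        finally show ?thesis using True by simp
      next
        case False
        have "K y s = 0" for y
          using False norm_snd_le[of s y] by (auto simp: K_def indicator_def)
        with False show ?thesis by simp
      qed
    qed
  qed (use borel_measurable_integrable[OF lborel_pair.integrable_snd[OF K_int]] in auto)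
  also have "\<dots> = (LINT s:{0..1}|lborel. s ^ j * (1 - s\<^sup>2) powr ((real m + ?N) / 2)) * ?I"
    by (simp only: integral_mult_left_zero set_lebesgue_integral_def)
  also have "(LINT s:{0..1}|lborel. s ^ j * (1 - s\<^sup>2) powr ((real m + ?N) / 2)) =
      integral {0..1} (\<lambda>s. s ^ j * (1 - s\<^sup>2) powr ((real m + ?N) / 2))"
    by (intro set_borel_integral_eq_integral set_integrable_weight continuous_intros) simp
  finally show ?thesis .
qed

text \<open>
  Integrate the derivative of \<open>s\<^bsup>j+1\<^esup> (1 - s\<^sup>2)\<^sup>a\<close>, which vanishes at both ends of the interval.
\<close>

lemma weight_recursion:
  assumes a: "a \<ge> 1"
  shows "(real j + 1 + 2 * a) * integral {0..1} (\<lambda>s. s ^ j * (1 - s\<^sup>2) powr a) =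
    2 * a * integral {0..1} (\<lambda>s. s ^ j * (1 - s\<^sup>2) powr (a - 1))"
proof -
  have "((\<lambda>s. (real j + 1 + 2 * a) * (s ^ j * (1 - s\<^sup>2) powr a) - 2 * a * (s ^ j * (1 - s\<^sup>2) powr (a - 1)))
      has_integral ((1 ^ Suc j * (1 - 1\<^sup>2) powr a) - (0 ^ Suc j * (1 - 0\<^sup>2) powr a))) {0..1::real}"
  proof (rule fundamental_theorem_of_calculus_interior)
    show "continuous_on {0..1} (\<lambda>s. s ^ Suc j * (1 - s\<^sup>2) powr a)"
      using a by (intro continuous_intros continuous_on_powr') (auto simp: power_le_one)
    fix s :: real assume s: "s \<in> {0<..<1}"
    then have s2: "s\<^sup>2 < 1" by (simp add: abs_square_less_1)
    have p: "(1 - s\<^sup>2) powr a = (1 - s\<^sup>2) * (1 - s\<^sup>2) powr (a - 1)"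
      using s2 by (simp add: powr_mult_base)
    have "((\<lambda>s. s ^ Suc j * (1 - s\<^sup>2) powr a) has_real_derivative
        (real j + 1) * s ^ j * (1 - s\<^sup>2) powr a + s ^ Suc j * (a * (1 - s\<^sup>2) powr (a - 1) * (- 2 * s))) (at s)"
      using s2 by (auto intro!: derivative_eq_intros simp del: power_Suc simp: algebra_simps)
    also have "(real j + 1) * s ^ j * (1 - s\<^sup>2) powr a + s ^ Suc j * (a * (1 - s\<^sup>2) powr (a - 1) * (- 2 * s)) =
       (real j + 1 + 2 * a) * (s ^ j * (1 - s\<^sup>2) powr a) - 2 * a * (s ^ j * (1 - s\<^sup>2) powr (a - 1))"
      unfolding p by (simp add: algebra_simps power2_eq_square)
    finally show "((\<lambda>s. s ^ Suc j * (1 - s\<^sup>2) powr a) has_vector_derivative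
        (real j + 1 + 2 * a) * (s ^ j * (1 - s\<^sup>2) powr a) - 2 * a * (s ^ j * (1 - s\<^sup>2) powr (a - 1))) (at s)"
      by (simp add: has_real_derivative_iff_has_vector_derivative)
  qed simp
  moreover have "(\<lambda>s. s ^ j * (1 - s\<^sup>2) powr a) integrable_on {0..1::real}"
    "(\<lambda>s. s ^ j * (1 - s\<^sup>2) powr (a - 1)) integrable_on {0..1::real}"
    using a by (intro set_borel_integral_eq_integral set_integrable_weight continuous_intros; simp)+
  ultimately show ?thesis
    using a by (simp add: has_integral_iff integral_diff integrable_on_cmult_left)
qed

text \<open>
  Passing from the hemisphere to the half ball and from the ball to the lower-dimensional sphere
  costs the factors \<open>DIM('a) + 1 + m + j\<close> and \<open>DIM('a) + m\<close>; the recursion for the weights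
  absorbs their quotient by lowering the exponent of \<open>1 - s\<^sup>2\<close> by 1.
\<close>

lemma hemisphere_integral_product:
  fixes g :: "'a::euclidean_space \<Rightarrow> real"
  assumes g: "g \<in> homogeneous_polynomials m" and N: "DIM('a) \<ge> 2"
  shows "(LINT z:{z \<in> sphere 0 1. snd z \<ge> 0}|surface_measure. g (fst z) * snd z ^ j) =
    integral {0..1} (\<lambda>s. s ^ j * (1 - s\<^sup>2) powr ((real m + DIM('a)) / 2 - 1)) *
    (LINT y:sphere 0 1|surface_measure. g y)"
proof -
  let ?N = "DIM('a)"
  let ?f = "\<lambda>z :: 'a \<times> real. g (fst z) * snd z ^ j * indicator {0..} (snd z)"
  note cont = homogeneous_polynomials_continuous[OF g]
  have gm [measurable]: "g \<in> borel_measurable borel" by (intro borel_measurable_continuous_onI cont)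
  have [measurable]: "fst \<in> borel_measurable (borel :: ('a \<times> real) measure)"
    "snd \<in> borel_measurable (borel :: ('a \<times> real) measure)"
    by (intro borel_measurable_continuous_onI continuous_intros)+
  have bnd: "\<exists>M. \<forall>x\<in>cball 0 1. \<bar>g x\<bar> \<le> M"
    using compact_imp_bounded[OF compact_continuous_image[OF cont compact_cball, of "0::'a" 1]]
    by (auto simp: bounded_iff)
  then obtain M where M: "\<And>x. x \<in> cball 0 1 \<Longrightarrow> \<bar>g x\<bar> \<le> M" by blast
  have "(LINT z:{z \<in> sphere 0 1. snd z \<ge> 0}|surface_measure. g (fst z) * snd z ^ j) =
      (LINT z:sphere 0 1|surface_measure. ?f z)"
    unfolding set_lebesgue_integral_def by (intro Bochner_Integration.integral_cong) (auto simp: indicator_def)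
  also have "\<dots> = (DIM('a \<times> real) + (m + j)) * (LINT z:cball 0 1|lborel. ?f z)"
  proof (rule sphere_integral_homogeneous)
    show "?f \<in> borel_measurable borel"
      by measurable
    fix c :: real and z :: "'a \<times> real" assume "c > 0"
    then show "?f (c *\<^sub>R z) = c ^ (m + j) * ?f z"
      by (auto simp: homogeneous_polynomials_scaleR[OF g] indicator_def power_mult_distrib power_add
          zero_le_mult_iff)
  next
    fix z :: "'a \<times> real" assume z: "z \<in> sphere 0 1"
    have 1: "norm (fst z) \<le> 1" "\<bar>snd z\<bar> \<le> 1"
      using norm_fst_le[of "fst z" "snd z"] norm_snd_le[of "snd z" "fst z"] z by simp_all
    then have "\<bar>?f z\<bar> \<le> \<bar>g (fst z)\<bar>"
      by (auto simp: abs_mult indicator_def power_abs intro!: mult_left_le power_le_one)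
    also have "\<dots> \<le> M" using M 1 by simp
    finally show "\<bar>?f z\<bar> \<le> M" .
  qed
  also have "(LINT z:cball 0 1|lborel. ?f z) =
      integral {0..1} (\<lambda>s. s ^ j * (1 - s\<^sup>2) powr ((real m + ?N) / 2)) * (LINT y:cball 0 1|lborel. g y)"
    by (intro half_ball_integral cont homogeneous_polynomials_scaleR[OF g])
  also have "real (DIM('a \<times> real) + (m + j)) = real j + 1 + 2 * ((real m + ?N) / 2)" by simp
  also have "\<dots> * (integral {0..1} (\<lambda>s. s ^ j * (1 - s\<^sup>2) powr ((real m + ?N) / 2)) * (LINT y:cball 0 1|lborel. g y)) =
      integral {0..1} (\<lambda>s. s ^ j * (1 - s\<^sup>2) powr ((real m + ?N) / 2 - 1)) * ((?N + m) * (LINT y:cball 0 1|lborel. g y))"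
    unfolding mult.assoc[symmetric] using N by (subst weight_recursion) auto
  also have "(?N + m) * (LINT y:cball 0 1|lborel. g y) = (LINT y:sphere 0 1|surface_measure. g y)"
    by (rule sphere_integral_homogeneous[symmetric, where M=M])
       (use M homogeneous_polynomials_scaleR[OF g] in auto)
  finally show ?thesis .
qed

section \<open>The orthogonal polynomials in the height\<close>

lemma lam_nonneg: "d \<ge> 2 \<Longrightarrow> lam d i \<ge> 0"
  by (simp add: lam_def)

lemma weight_integrable_on:
  fixes q :: "real \<Rightarrow> real"
  assumes "continuous_on UNIV q" and "d \<ge> 2"
  shows "(\<lambda>x. q x * (1 - x\<^sup>2) powr lam d i) integrable_on {0..1}"
  by (intro set_borel_integral_eq_integral set_integrable_weight assms lam_nonneg)

text \<open>
  Only the interval \<open>[0, 1/2]\<close> is examined: there the integrand is continuous, whereas at \<open>1\<close> the weight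
  jumps to \<open>0 powr 0 = 0\<close> when the exponent is \<open>0\<close>.
\<close>

lemma weight_integral_pos:
  assumes q: "q \<noteq> 0" and d: "d \<ge> 2"
  shows "integral {0..1} (\<lambda>x. (poly q x)\<^sup>2 * (1 - x\<^sup>2) powr lam d i) > 0" (is "integral _ ?f > 0")
proof -
  have int: "?f integrable_on {0..1}"
    by (intro weight_integrable_on d continuous_intros)
  have sub: "integral {0..1/2} ?f \<le> integral {0..1} ?f"
    by (rule integral_subset_le) (auto intro: integrable_on_subinterval[OF int] int)
  have cont: "continuous_on {0..1/2} ?f"
  proof (intro continuous_intros continuous_on_powr ballI)
    fix x :: real assume "x \<in> {0..1/2}"
    then have "x\<^sup>2 \<le> (1/2)\<^sup>2" by (intro power_mono) auto
    then show "1 - x\<^sup>2 \<noteq> 0" by (auto simp: power2_eq_square)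
  qed
  have "integral {0..1/2} ?f \<noteq> 0"
  proof
    assume "integral {0..1/2} ?f = 0"
    then have z: "?f x = 0" if "x \<in> {0..1/2}" for x
      using integral_eq_0_iff[OF cont, simplified] that by simp
    have "poly q x = 0" if x: "x \<in> {0..1/2}" for x
    proof -
      have "x\<^sup>2 \<le> (1/2)\<^sup>2" using x by (intro power_mono) auto
      then have "1 - x\<^sup>2 \<noteq> 0" by (auto simp: power2_eq_square)
      with z[OF x] show ?thesis by simp
    qed
    then have "{0..1/2} \<subseteq> {x. poly q x = 0}" by blast
    then have "finite {0..1/2::real}" using poly_roots_finite[OF q] finite_subset by blast
    then show False by (simp add: infinite_Icc)
  qed
  moreover have "integral {0..1/2} ?f \<ge> 0"
    by (rule integral_nonneg) (auto intro: integrable_on_subinterval[OF int])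
  ultimately show ?thesis using sub by linarith
qed

lemma weight_integral_sum_moments:
  assumes d: "d \<ge> 2"
  shows "integral {0..1} (\<lambda>x. (\<Sum>b\<in>B. c b * x ^ n b) * (1 - x\<^sup>2) powr lam d i) = (\<Sum>b\<in>B. c b * moment d i (n b))"
proof (cases "finite B")
  case True
  have "integral {0..1} (\<lambda>x. (\<Sum>b\<in>B. c b * x ^ n b) * (1 - x\<^sup>2) powr lam d i) =
      integral {0..1} (\<lambda>x. \<Sum>b\<in>B. c b * (x ^ n b * (1 - x\<^sup>2) powr lam d i))"
    by (simp add: sum_distrib_right mult.assoc)
  also have "\<dots> = (\<Sum>b\<in>B. integral {0..1} (\<lambda>x. c b * (x ^ n b * (1 - x\<^sup>2) powr lam d i)))"
    by (intro integral_sum True integrable_on_mult_right weight_integrable_on d continuous_intros)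
  also have "\<dots> = (\<Sum>b\<in>B. c b * moment d i (n b))"
    by (simp add: moment_def)
  finally show ?thesis .
qed simp

text \<open>
  This is the Gram matrix of \<open>1, x, \<dots>, x\<^bsup>j-1\<^esup>\<close>: a kernel vector would be the coefficient vector of a
  nonzero polynomial whose square has weighted integral \<open>0\<close>.
\<close>

lemma det_moment_matrix_nonzero:
  assumes d: "d \<ge> 2"
  shows "det (mat j j (\<lambda>(a, b). moment d i (a + b))) \<noteq> 0"
proof
  let ?H = "mat j j (\<lambda>(a, b). moment d i (a + b))"
  assume "det ?H = 0"
  then obtain v where v: "v \<in> carrier_vec j" "v \<noteq> 0\<^sub>v j" and Hv: "?H *\<^sub>v v = 0\<^sub>v j"
    using det_0_iff_vec_prod_zero[of ?H j] by auto
  have row: "(\<Sum>b<j. moment d i (a + b) * vec_index v b) = 0" if a: "a < j" for a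
  proof -
    have "vec_index (?H *\<^sub>v v) a = 0" using Hv a by simp
    then show ?thesis using a v(1) by (simp add: scalar_prod_def lessThan_atLeast0)
  qed
  define q where "q = (\<Sum>b<j. Polynomial.monom (vec_index v b) b)"
  have qx: "poly q x = (\<Sum>b<j. vec_index v b * x ^ b)" for x
    by (simp add: q_def poly_sum poly_monom)
  have "q \<noteq> 0"
  proof
    assume q0: "q = 0"
    have "vec_index v b = 0" if "b < j" for b
    proof -
      have "coeff q b = vec_index v b"
        using that by (simp add: q_def coeff_sum)
      with q0 show ?thesis by simp
    qed
    then have "v = 0\<^sub>v j" using v(1) by (intro eq_vecI) auto
    with v(2) show False by simp
  qed
  then have "integral {0..1} (\<lambda>x. (poly q x)\<^sup>2 * (1 - x\<^sup>2) powr lam d i) > 0"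
    by (rule weight_integral_pos[OF _ d])
  also have "(\<lambda>x. (poly q x)\<^sup>2) =
      (\<lambda>x. \<Sum>p\<in>{..<j} \<times> {..<j}. (vec_index v (fst p) * vec_index v (snd p)) * x ^ (fst p + snd p))"
    by (simp add: qx power2_eq_square sum_product sum.cartesian_product case_prod_unfold power_add algebra_simps)
  then have "integral {0..1} (\<lambda>x. (poly q x)\<^sup>2 * (1 - x\<^sup>2) powr lam d i) =
      integral {0..1} (\<lambda>x. (\<Sum>p\<in>{..<j} \<times> {..<j}. (vec_index v (fst p) * vec_index v (snd p)) * x ^ (fst p + snd p)) *
        (1 - x\<^sup>2) powr lam d i)"
    by (simp add: fun_eq_iff)
  also have "\<dots> = (\<Sum>p\<in>{..<j} \<times> {..<j}. (vec_index v (fst p) * vec_index v (snd p)) * moment d i (fst p + snd p))"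
    by (rule weight_integral_sum_moments[OF d])
  also have "\<dots> = (\<Sum>a<j. vec_index v a * (\<Sum>b<j. moment d i (a + b) * vec_index v b))"
    by (simp add: sum.cartesian_product' sum_distrib_left mult_ac)
  also have "\<dots> = 0" by (simp add: row)
  finally show False by simp
qed

text \<open>
  Expand the determinant along its last row. Pairing with \<open>x\<^sup>a\<close> replaces that row by row \<open>a\<close>, so the
  determinant vanishes for \<open>a < j\<close>; the cofactor of \<open>x\<^sup>j\<close> is the determinant by which \<open>p_poly\<close> divides.
\<close>

lemma p_poly_expansion:
  assumes d: "d \<ge> 2"
  obtains c where "\<And>x. p_poly d j i x = (\<Sum>b\<le>j. c b * x ^ b)" "c j = 1"
    "\<And>a. a < j \<Longrightarrow> (\<Sum>b\<le>j. c b * moment d i (a + b)) = 0"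
proof (cases "j = 0")
  case True
  show ?thesis by (rule that[of "\<lambda>_. 1"]) (use True in \<open>auto simp: p_poly_def\<close>)
next
  case False
  \<comment> \<open>The last row is a parameter, as both the powers of \<open>x\<close> and shifted moments are inserted there.\<close>
  define A where "A v = mat (j + 1) (j + 1) (\<lambda>(a, b). if a < j then moment d i (a + b) else v b)" for v
  define \<Delta> where "\<Delta> = det (mat j j (\<lambda>(a, b). moment d i (a + b)))"
  have \<Delta>: "\<Delta> \<noteq> 0" unfolding \<Delta>_def by (rule det_moment_matrix_nonzero[OF d])
  define D where "D b = mat_delete (A (\<lambda>_. 0)) j b" for b
  define C where "C b = (-1) ^ (j + b) * det (D b)" for b
  have dim: "A v \<in> carrier_mat (j + 1) (j + 1)" for v by (simp add: A_def)
  have del: "mat_delete (A v) j b = D b" for v b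
    unfolding D_def by (rule eq_matI) (auto simp: A_def mat_delete_def)
  have det: "det (A v) = (\<Sum>b\<le>j. C b * v b)" for v
  proof -
    have "det (A v) = (\<Sum>b<j + 1. A v $$ (j, b) * cofactor (A v) j b)"
      by (rule laplace_expansion_row[OF dim]) simp
    also have "\<dots> = (\<Sum>b<j + 1. C b * v b)"
      by (intro sum.cong refl) (simp add: C_def cofactor_def del, simp add: A_def)
    finally show ?thesis by (simp add: lessThan_Suc_atMost)
  qed
  have "D j = mat j j (\<lambda>(a, b). moment d i (a + b))"
    unfolding D_def by (rule eq_matI) (auto simp: A_def mat_delete_def)
  then have Cj: "C j = \<Delta>" by (simp add: C_def \<Delta>_def flip: mult_2)
  show ?thesis
  proof (rule that[of "\<lambda>b. C b / \<Delta>"])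
    show "p_poly d j i x = (\<Sum>b\<le>j. C b / \<Delta> * x ^ b)" for x
    proof -
      have "p_poly d j i x = 1 / \<Delta> * det (A (\<lambda>b. x ^ b))"
        using False by (simp add: p_poly_def \<Delta>_def A_def)
      then show ?thesis by (simp add: det sum_divide_distrib)
    qed
    show "C j / \<Delta> = 1" using Cj \<Delta> by simp
    fix a assume a: "a < j"
    have "det (A (\<lambda>b. moment d i (a + b))) = 0"
      by (rule det_identical_rows[OF dim, of a j]) (use a in \<open>auto simp: A_def intro!: eq_vecI\<close>)
    then show "(\<Sum>b\<le>j. C b / \<Delta> * moment d i (a + b)) = 0"
      by (simp add: det flip: sum_divide_distrib)
  qed
qed

lemma p_poly_polynomial:
  assumes d: "d \<ge> 2"
  obtains P where "\<And>x. p_poly d j i x = poly P x" "degree P = j" "coeff P j = 1"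
proof -
  obtain c where c: "\<And>x. p_poly d j i x = (\<Sum>b\<le>j. c b * x ^ b)" "c j = 1"
    "\<And>a. a < j \<Longrightarrow> (\<Sum>b\<le>j. c b * moment d i (a + b)) = 0"
    using p_poly_expansion[OF d, of j i] by blast
  define P where "P = (\<Sum>b\<le>j. Polynomial.monom (c b) b)"
  have co: "coeff P n = (if n \<le> j then c n else 0)" for n by (simp add: P_def coeff_sum)
  show ?thesis
  proof (rule that[of P])
    show "p_poly d j i x = poly P x" for x by (simp add: c P_def poly_sum poly_monom)
    show "coeff P j = 1" by (simp add: co c)
    then show "degree P = j" by (intro antisym degree_le le_degree) (auto simp: co)
  qed
qed

lemma p_poly_orthogonal_1:
  assumes d: "d \<ge> 2" and j: "j > 0"
  shows "integral {0..1} (\<lambda>x. p_poly d j i x * (1 - x\<^sup>2) powr lam d i) = 0"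
proof -
  obtain c where c: "\<And>x. p_poly d j i x = (\<Sum>b\<le>j. c b * x ^ b)" "c j = 1"
    "\<And>a. a < j \<Longrightarrow> (\<Sum>b\<le>j. c b * moment d i (a + b)) = 0"
    using p_poly_expansion[OF d, of j i] by blast
  show ?thesis
    unfolding c(1) weight_integral_sum_moments[OF d] using c(3)[OF j] by simp
qed

lemma Psi_eq:
  assumes d: "d \<ge> 2"
  obtains r where "r > 0" "\<And>x. Psi d j i x = p_poly d j i x / r"
proof -
  obtain P where P: "\<And>x. p_poly d j i x = poly P x" "degree P = j" "coeff P j = 1"
    using p_poly_polynomial[OF d, of j i] by blast
  from P(3) have "P \<noteq> 0" by auto
  then have "integral {0..1} (\<lambda>u. (p_poly d j i u)\<^sup>2 * (1 - u\<^sup>2) powr lam d i) > 0"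
    unfolding P(1) by (rule weight_integral_pos[OF _ d])
  then show ?thesis by (intro that[of "sqrt (integral {0..1} (\<lambda>u. (p_poly d j i u)\<^sup>2 * (1 - u\<^sup>2) powr lam d i))"]) (auto simp: Psi_def)
qed

text \<open>
  \<open>Psi d r i\<close> has degree exactly \<open>r\<close>, so the leading coefficient can be removed one degree at a time.
\<close>

lemma poly_in_span_Psi:
  assumes d: "d \<ge> 2"
  shows "degree q \<le> n \<Longrightarrow> \<exists>c. \<forall>x. poly q x = (\<Sum>r\<le>n. c r * Psi d r i x)"
proof (induction n arbitrary: q)
  case 0
  obtain r where r: "r > 0" "\<And>x. Psi d 0 i x = p_poly d 0 i x / r"
    using Psi_eq[OF d, of 0 i] by blast
  obtain a where "q = [:a:]" using 0 by (auto elim: degree_eq_zeroE)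
  then show ?case using r by (intro exI[of _ "\<lambda>_. a * r"]) (simp add: p_poly_def)
next
  case (Suc n)
  obtain r where r: "r > 0" "\<And>x. Psi d (Suc n) i x = p_poly d (Suc n) i x / r"
    using Psi_eq[OF d, of "Suc n" i] by blast
  obtain P where P: "\<And>x. p_poly d (Suc n) i x = poly P x" "degree P = Suc n" "coeff P (Suc n) = 1"
    using p_poly_polynomial[OF d, of "Suc n" i] by blast
  let ?a = "coeff q (Suc n)"
  have "degree (q - Polynomial.smult ?a P) \<le> n"
  proof (rule degree_le, intro allI impI)
    fix k assume "n < k"
    then show "coeff (q - Polynomial.smult ?a P) k = 0"
      using P Suc.prems by (cases "k = Suc n") (auto simp: coeff_eq_0)
  qed
  from Suc.IH[OF this] obtain c where c: "\<And>x. poly (q - Polynomial.smult ?a P) x = (\<Sum>r\<le>n. c r * Psi d r i x)" by blast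
  have "poly q x = (\<Sum>k\<le>Suc n. (c(Suc n := ?a * r)) k * Psi d k i x)" for x
    using c[of x] r P by simp
  then show ?case by blast
qed

section \<open>Polynomials and harmonics on the hemisphere\<close>

lemma monomial_prod:
  fixes \<alpha> :: "('a::euclidean_space \<times> real) \<Rightarrow> nat"
  shows "monomial \<alpha> z = monomial (\<lambda>u. \<alpha> (u, 0)) (fst z) * snd z ^ \<alpha> (0, 1)"
proof -
  have "monomial \<alpha> z = (\<Prod>b\<in>(\<lambda>u. (u, 0)) ` Basis. inner z b ^ \<alpha> b) * (\<Prod>b\<in>{(0, 1)}. inner z b ^ \<alpha> b)"
    unfolding monomial_def Basis_prod_def by (subst prod.union_disjoint) auto
  also have "(\<Prod>b\<in>(\<lambda>u. (u, 0)) ` Basis. inner z b ^ \<alpha> b) = monomial (\<lambda>u. \<alpha> (u, 0)) (fst z)"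
    unfolding monomial_def by (subst prod.reindex) (auto simp: inj_on_def inner_prod_def)
  finally show ?thesis by (simp add: inner_prod_def)
qed

lemma monomial_degree_prod:
  fixes \<alpha> :: "('a::euclidean_space \<times> real) \<Rightarrow> nat"
  shows "monomial_degree \<alpha> = monomial_degree (\<lambda>u. \<alpha> (u, 0)) + \<alpha> (0, 1)"
proof -
  have "monomial_degree \<alpha> = (\<Sum>b\<in>(\<lambda>u. (u, 0)) ` Basis. \<alpha> b) + (\<Sum>b\<in>{(0, 1)}. \<alpha> b)"
    unfolding monomial_degree_def Basis_prod_def by (subst sum.union_disjoint) auto
  also have "(\<Sum>b\<in>(\<lambda>u. (u, 0)) ` Basis. \<alpha> b) = monomial_degree (\<lambda>u. \<alpha> (u, 0))"
    unfolding monomial_degree_def by (subst sum.reindex) (auto simp: inj_on_def)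
  finally show ?thesis by simp
qed

lemma homogeneous_polynomials_prod:
  fixes g :: "'a::euclidean_space \<Rightarrow> real"
  assumes "g \<in> homogeneous_polynomials m"
  shows "(\<lambda>z. c * (g (fst z) * snd z ^ j)) \<in> (homogeneous_polynomials (m + j) :: ('a \<times> real \<Rightarrow> real) set)"
  using assms
proof (induction rule: homogeneous_polynomials_induct)
  case zero
  show ?case using homogeneous_polynomials_zero by simp
next
  case (step e \<alpha> p)
  let ?\<beta> = "\<lambda>b :: 'a \<times> real. if snd b = 0 then \<alpha> (fst b) else j"
  have "monomial_degree ?\<beta> = m + j" using step(1) by (simp add: monomial_degree_prod)
  from homogeneous_polynomials_step[OF step(3) this, of "c * e"]
  show ?case by (simp add: monomial_prod algebra_simps)
qed

lemma polynomials_le_product: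
  fixes g :: "'a::euclidean_space \<Rightarrow> real"
  assumes g: "g \<in> homogeneous_polynomials m" and q: "m + degree q \<le> t"
  shows "(\<lambda>z. g (fst z) * poly q (snd z)) \<in> (polynomials_le t :: ('a \<times> real \<Rightarrow> real) set)"
proof -
  have "(\<lambda>z. \<Sum>j\<le>degree q. coeff q j * (g (fst z) * snd z ^ j)) \<in> (polynomials_le t :: ('a \<times> real \<Rightarrow> real) set)"
    unfolding polynomials_le_eq
  proof (rule monomial_combinations_sum)
    fix j assume "j \<in> {..degree q}"
    with q have "m + j \<le> t" by simp
    from homogeneous_polynomials_prod[OF g, of "coeff q j" j]
    show "(\<lambda>z. coeff q j * (g (fst z) * snd z ^ j)) \<in>
        monomial_combinations (\<lambda>\<alpha> :: 'a \<times> real \<Rightarrow> nat. monomial_degree \<alpha> \<le> t)"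
      unfolding homogeneous_polynomials_eq by (rule monomial_combinations_mono) (use \<open>m + j \<le> t\<close> in simp)
  qed
  then show ?thesis by (simp add: poly_altdef sum_distrib_left mult_ac)
qed

lemma hemisphere_polar:
  fixes x :: "(real ^ 'n::finite) \<times> real"
  assumes "x \<in> hemisphere"
  obtains u \<theta> where "u \<in> sphere 0 1" "\<theta> \<in> {0..pi/2}" "x = (sin \<theta> *\<^sub>R u, cos \<theta>)"
proof -
  obtain y s where x: "x = (y, s)" by (cases x)
  have s: "0 \<le> s" and ys: "(norm y)\<^sup>2 + s\<^sup>2 = 1"
    using assms by (auto simp: hemisphere_def x norm_Pair)
  have s1: "s \<le> 1" using ys s by (smt (verit) power2_le_imp_le zero_le_power2 one_power2)
  define \<theta> where "\<theta> = arccos s"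
  have \<theta>: "\<theta> \<in> {0..pi/2}" "cos \<theta> = s"
    using s s1 arccos_lbound[of s] arccos_le_pi2[of s] by (simp_all add: \<theta>_def)
  have "sin \<theta> \<ge> 0" using \<theta> by (intro sin_ge_zero) auto
  moreover have "(sin \<theta>)\<^sup>2 = (norm y)\<^sup>2" using ys \<theta>(2) by (simp add: sin_squared_eq)
  ultimately have sn: "sin \<theta> = norm y" by (simp add: power2_eq_iff_nonneg)
  define u where "u = (if y = 0 then (SOME b. b \<in> Basis) else sgn y)"
  have "u \<in> sphere 0 1"
    using some_in_eq[of "Basis :: (real ^ 'n) set"] by (auto simp: u_def norm_sgn)
  moreover have "sin \<theta> *\<^sub>R u = y" by (simp add: sn u_def sgn_div_norm)
  ultimately show ?thesis using that \<theta> by (simp add: x)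
qed

lemma closed_hemisphere: "closed (hemisphere :: ((real ^ 'n::finite) \<times> real) set)"
proof -
  have "hemisphere = sphere 0 1 \<inter> {z :: (real ^ 'n) \<times> real. 0 \<le> snd z}"
    by (auto simp: hemisphere_def)
  also have "closed \<dots>"
    by (intro closed_Int closed_Collect_le continuous_intros) simp
  finally show ?thesis .
qed

lemma hemisphere_subset_sphere: "hemisphere \<subseteq> sphere 0 1"
  by (auto simp: hemisphere_def)

lemma sets_hemisphere: "hemisphere \<in> sets surface_measure"
  using borel_closed[OF closed_hemisphere] by simp

text \<open>
  The integral factors over height and equator. For \<open>m = 0\<close> the exponent of \<open>1 - s\<^sup>2\<close> is the one in the
  orthogonality of the polynomials \<open>p_poly d j 0\<close>.
\<close>

lemma hemisphere_integral_poly: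
  fixes g :: "real ^ 'n::finite \<Rightarrow> real"
  assumes g: "g \<in> homogeneous_polynomials m" and d: "CARD('n) \<ge> 2"
  shows "(LINT z:hemisphere|surface_measure. g (fst z) * poly q (snd z)) =
    integral {0..1} (\<lambda>s. poly q s * (1 - s\<^sup>2) powr ((real m + CARD('n)) / 2 - 1)) *
    (LINT y:sphere 0 1|surface_measure. g y)"
proof -
  let ?a = "(real m + CARD('n)) / 2 - 1"
  have cg: "continuous_on UNIV (\<lambda>z :: (real ^ 'n) \<times> real. g (fst z) * snd z ^ j)" for j
    by (intro continuous_intros continuous_on_compose2[OF homogeneous_polynomials_continuous[OF g, of UNIV]]) auto
  have int: "set_integrable surface_measure hemisphere (\<lambda>z :: (real ^ 'n) \<times> real. coeff q j * (g (fst z) * snd z ^ j))" for j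
    by (intro set_integrable_surface_measure closed_hemisphere hemisphere_subset_sphere continuous_on_mult
        continuous_on_const cg)
  have "(LINT z:hemisphere|surface_measure. g (fst z) * poly q (snd z)) =
      (LINT z:hemisphere|surface_measure. \<Sum>j\<le>degree q. coeff q j * (g (fst z) * snd z ^ j))"
    by (simp add: poly_altdef sum_distrib_left mult_ac)
  also have "\<dots> = (\<Sum>j\<le>degree q. LINT z:hemisphere|surface_measure. coeff q j * (g (fst z) * snd z ^ j))"
    using int unfolding set_lebesgue_integral_def set_integrable_def scaleR_sum_right
    by (intro Bochner_Integration.integral_sum)
  also have "\<dots> = (\<Sum>j\<le>degree q. coeff q j * (integral {0..1} (\<lambda>s. s ^ j * (1 - s\<^sup>2) powr ?a) *
      (LINT y:sphere 0 1|surface_measure. g y)))"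
    using hemisphere_integral_product[OF g] d
    by (simp only: set_integral_mult_right hemisphere_def DIM_cart DIM_real mult_1_right mult_1_left)
  also have "\<dots> = (\<Sum>j\<le>degree q. integral {0..1} (\<lambda>s. coeff q j * (s ^ j * (1 - s\<^sup>2) powr ?a))) *
      (LINT y:sphere 0 1|surface_measure. g y)"
    by (simp add: sum_distrib_right mult.assoc)
  also have "(\<Sum>j\<le>degree q. integral {0..1} (\<lambda>s. coeff q j * (s ^ j * (1 - s\<^sup>2) powr ?a))) =
      integral {0..1} (\<lambda>s. \<Sum>j\<le>degree q. coeff q j * (s ^ j * (1 - s\<^sup>2) powr ?a))"
    using d by (intro integral_sum[symmetric] integrable_on_mult_right set_borel_integral_eq_integral
        set_integrable_weight continuous_intros) auto
  also have "(\<lambda>s. \<Sum>j\<le>degree q. coeff q j * (s ^ j * (1 - s\<^sup>2) powr ?a)) = (\<lambda>s. poly q s * (1 - s\<^sup>2) powr ?a)"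
    by (simp add: poly_altdef sum_distrib_right mult.assoc)
  finally show ?thesis .
qed

lemma index_degree_le: "k \<in> index_set d l \<Longrightarrow> index_degree k \<le> l"
  by (auto simp: index_set_def index_degree_def)

lemma index_set_of_degree_le: "k \<in> (\<Union>l. index_set d l) \<Longrightarrow> index_degree k \<le> l \<Longrightarrow> k \<in> index_set d l"
  by (auto simp: index_set_def index_degree_def)

lemma spherical_harmonic_systemD:
  fixes Y :: "int list \<Rightarrow> real ^ 'n::finite \<Rightarrow> real"
  assumes "spherical_harmonic_system Y"
  shows "k \<in> index_set CARD('n) l \<Longrightarrow> Y k \<in> spherical_harmonics (index_degree k)"
    and "k \<in> index_set CARD('n) l \<Longrightarrow> k' \<in> index_set CARD('n) l' \<Longrightarrow>
      (LINT u:sphere 0 1|surface_measure. Y k u * Y k' u) = (if k = k' then 1 else 0)"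
    and "h \<in> spherical_harmonics m \<Longrightarrow> \<exists>c. \<forall>u\<in>sphere 0 1.
      h u = (\<Sum>k | k \<in> (\<Union>l. index_set CARD('n) l) \<and> index_degree k = m. c k * Y k u)"
proof -
  let ?K = "\<Union>l. index_set CARD('n) l"
  note Y = assms[unfolded spherical_harmonic_system_def Let_def]
  have K: "k \<in> ?K" if "k \<in> index_set CARD('n) l" for k l using that by blast
  show "Y k \<in> spherical_harmonics (index_degree k)" if "k \<in> index_set CARD('n) l"
    using Y[THEN conjunct1] K[OF that] by (rule bspec)
  show "(LINT u:sphere 0 1|surface_measure. Y k u * Y k' u) = (if k = k' then 1 else 0)"
    if "k \<in> index_set CARD('n) l" "k' \<in> index_set CARD('n) l'"
    using bspec[OF bspec[OF Y[THEN conjunct2, THEN conjunct1] K[OF that(1)]] K[OF that(2)]] .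
  show "\<exists>c. \<forall>u\<in>sphere 0 1. h u = (\<Sum>k | k \<in> ?K \<and> index_degree k = m. c k * Y k u)"
    if "h \<in> spherical_harmonics m"
    using bspec[OF spec[OF Y[THEN conjunct2, THEN conjunct2]] that] .
qed

lemma harmonic_system_homogeneous:
  fixes Y :: "int list \<Rightarrow> real ^ 'n::finite \<Rightarrow> real"
  assumes "spherical_harmonic_system Y" "k \<in> index_set CARD('n) l"
  obtains H where "H \<in> homogeneous_polynomials (index_degree k)" "\<And>u. u \<in> sphere 0 1 \<Longrightarrow> Y k u = H u"
proof -
  have "Y k \<in> spherical_harmonics (index_degree k)"
    by (rule spherical_harmonic_systemD(1)[OF assms])
  then show ?thesis using that unfolding spherical_harmonics_def by auto
qed

text \<open>
  The index with all entries \<open>0\<close> belongs to a constant function of norm \<open>1\<close>. This also shows that the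
  sphere has nonzero measure.
\<close>

lemma harmonic_system_constant:
  fixes Y :: "int list \<Rightarrow> real ^ 'n::finite \<Rightarrow> real"
  assumes d: "CARD('n) \<ge> 2" and Y: "spherical_harmonic_system Y"
  shows "\<exists>k\<in>index_set CARD('n) 0. \<exists>c. index_degree k = 0 \<and> c \<noteq> 0 \<and> (\<forall>u\<in>sphere 0 1. Y k u = c)"
    and "measure surface_measure (sphere (0 :: real ^ 'n) 1) \<noteq> 0"
proof -
  define k where "k = replicate (CARD('n) - 1) (0::int)"
  have k: "k \<in> index_set CARD('n) 0" "index_degree k = 0"
    using d by (auto simp: k_def index_set_def index_degree_def)
  have h: "Y k \<in> spherical_harmonics 0"
    using spherical_harmonic_systemD(1)[OF Y k(1)] k(2) by simp
  obtain v :: "real ^ 'n" where v: "v \<in> sphere 0 1" using vector_choose_size[of 1] by (metis mem_sphere_0 zero_le_one)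
  define c where "c = Y k v"
  have c: "Y k u = c" if "u \<in> sphere 0 1" for u
    unfolding c_def by (rule spherical_harmonics_0_const[OF h that v])
  have "(LINT u:sphere 0 1|surface_measure. Y k u * Y k u) = 1"
    using spherical_harmonic_systemD(2)[OF Y k(1) k(1)] by simp
  also have "(LINT u:sphere 0 1|surface_measure. Y k u * Y k u) = (LINT u:sphere (0 :: real ^ 'n) 1|surface_measure. c * c)"
    by (rule set_lebesgue_integral_cong) (auto simp: c)
  also have "\<dots> = c * c * measure surface_measure (sphere (0 :: real ^ 'n) 1)"
    by (simp add: set_lebesgue_integral_def)
  finally have "c \<noteq> 0" and "measure surface_measure (sphere (0 :: real ^ 'n) 1) \<noteq> 0" by auto
  with k c show "\<exists>k\<in>index_set CARD('n) 0. \<exists>c. index_degree k = 0 \<and> c \<noteq> 0 \<and> (\<forall>u\<in>sphere 0 1. Y k u = c)"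
    and "measure surface_measure (sphere (0 :: real ^ 'n) 1) \<noteq> 0" by blast+
qed

text \<open>
  Functions of positive degree are orthogonal to the constant one.
\<close>

lemma harmonic_system_mean_zero:
  fixes Y :: "int list \<Rightarrow> real ^ 'n::finite \<Rightarrow> real"
  assumes d: "CARD('n) \<ge> 2" and Y: "spherical_harmonic_system Y"
    and k: "k \<in> index_set CARD('n) l" "index_degree k > 0"
  shows "(LINT u:sphere 0 1|surface_measure. Y k u) = 0"
proof -
  obtain k0 c where k0: "k0 \<in> index_set CARD('n) 0" "index_degree k0 = 0"
    and c: "c \<noteq> 0" "\<And>u. u \<in> sphere 0 1 \<Longrightarrow> Y k0 u = c"
    using harmonic_system_constant(1)[OF d Y] by blast
  have "k \<noteq> k0" using k k0 by auto
  then have "(LINT u:sphere 0 1|surface_measure. Y k u * Y k0 u) = 0"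
    using spherical_harmonic_systemD(2)[OF Y k(1) k0(1)] by simp
  also have "(LINT u:sphere 0 1|surface_measure. Y k u * Y k0 u) = (LINT u:sphere 0 1|surface_measure. c * Y k u)"
    by (rule set_lebesgue_integral_cong) (auto simp: c)
  also have "\<dots> = c * (LINT u:sphere 0 1|surface_measure. Y k u)"
    by (rule set_integral_mult_right)
  finally show ?thesis using c by simp
qed

text \<open>
  The factor \<open>sin \<theta> ^ m\<close> turns the spherical harmonic into its homogeneous extension.
\<close>

lemma B_fun_product:
  fixes Y :: "int list \<Rightarrow> real ^ 'n::finite \<Rightarrow> real"
  assumes Y: "spherical_harmonic_system Y" and k: "k \<in> index_set CARD('n) l"
    and H: "H \<in> homogeneous_polynomials (index_degree k)" "\<And>u. u \<in> sphere 0 1 \<Longrightarrow> Y k u = H u"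
    and z: "z \<in> hemisphere"
  shows "B_fun Y l k z = H (fst z) * Psi CARD('n) (l - index_degree k) (index_degree k) (snd z)"
proof -
  obtain u \<theta> where u: "u \<in> sphere 0 1" and \<theta>: "\<theta> \<in> {0..pi/2}" and zz: "z = (sin \<theta> *\<^sub>R u, cos \<theta>)"
    using hemisphere_polar[OF z] by blast
  show ?thesis
    unfolding zz B_fun_polar[OF Y k u \<theta>] by (simp add: homogeneous_polynomials_scaleR[OF H(1)] H(2)[OF u])
qed

lemma B_fun_polynomial:
  fixes Y :: "int list \<Rightarrow> real ^ 'n::finite \<Rightarrow> real"
  assumes d: "CARD('n) \<ge> 2" and Y: "spherical_harmonic_system Y" and k: "k \<in> index_set CARD('n) l"
  obtains H q where "H \<in> homogeneous_polynomials (index_degree k)" "\<And>u. u \<in> sphere 0 1 \<Longrightarrow> Y k u = H u"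
    "index_degree k + degree q = l"
    "\<And>z. z \<in> hemisphere \<Longrightarrow> B_fun Y l k z = H (fst z) * poly q (snd z)"
    "\<And>s. poly q s = Psi CARD('n) (l - index_degree k) (index_degree k) s"
proof -
  let ?m = "index_degree k"
  obtain H where H: "H \<in> homogeneous_polynomials ?m" "\<And>u. u \<in> sphere 0 1 \<Longrightarrow> Y k u = H u"
    using harmonic_system_homogeneous[OF Y k] by blast
  obtain r where r: "r > 0" "\<And>x. Psi CARD('n) (l - ?m) ?m x = p_poly CARD('n) (l - ?m) ?m x / r"
    using Psi_eq[OF d, of "l - ?m" ?m] by blast
  obtain P where P: "\<And>x. p_poly CARD('n) (l - ?m) ?m x = poly P x" "degree P = l - ?m" "coeff P (l - ?m) = 1"
    using p_poly_polynomial[OF d, of "l - ?m" ?m] by blast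
  define q where "q = Polynomial.smult (1 / r) P"
  have q: "poly q s = Psi CARD('n) (l - ?m) ?m s" for s using r P(1) by (simp add: q_def)
  show ?thesis
  proof (rule that[OF H _ _ q])
    show "?m + degree q = l" using r P(2) index_degree_le[OF k] by (simp add: q_def)
    show "B_fun Y l k z = H (fst z) * poly q (snd z)" if "z \<in> hemisphere" for z
      using B_fun_product[OF Y k H that] q by simp
  qed
qed

section \<open>Exact averages and designs\<close>

text \<open>
  Integrability is included so that exactness is preserved by addition: the integral of a
  non-integrable function is \<open>0\<close> by convention.
\<close>

definition quadrature_exact :: "((real ^ 'n::finite) \<times> real) set \<Rightarrow> ((real ^ 'n) \<times> real \<Rightarrow> real) \<Rightarrow> bool" where
  "quadrature_exact X f \<longleftrightarrow> set_integrable surface_measure hemisphere f \<and>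
     1 / measure surface_measure (hemisphere :: ((real ^ 'n) \<times> real) set) *
       (LINT x:hemisphere|surface_measure. f x) = 1 / real (card X) * (\<Sum>x\<in>X. f x)"

lemma quadrature_exact_cong:
  assumes f: "quadrature_exact X f" and X: "X \<subseteq> hemisphere"
    and eq: "\<And>x. x \<in> hemisphere \<Longrightarrow> g x = f x"
  shows "quadrature_exact X g"
proof -
  have "set_integrable surface_measure hemisphere g \<longleftrightarrow> set_integrable surface_measure hemisphere f"
    by (rule set_integrable_cong[OF refl refl eq])
  moreover have "(LINT x:hemisphere|surface_measure. g x) = (LINT x:hemisphere|surface_measure. f x)"
    using eq by (intro set_lebesgue_integral_cong sets_hemisphere) blast
  moreover have "(\<Sum>x\<in>X. g x) = (\<Sum>x\<in>X. f x)"
    by (rule sum.cong) (use X eq in auto)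
  ultimately show ?thesis using f by (simp add: quadrature_exact_def)
qed

lemma quadrature_exact_zero: "quadrature_exact X (\<lambda>_. 0)"
  by (simp add: quadrature_exact_def set_integrable_def set_lebesgue_integral_def)

lemma quadrature_exact_add:
  assumes "quadrature_exact X f" "quadrature_exact X g"
  shows "quadrature_exact X (\<lambda>x. f x + g x)"
  using assms by (simp add: quadrature_exact_def set_integral_add sum.distrib distrib_left del: times_divide_eq_left)

lemma quadrature_exact_cmult:
  fixes X :: "((real ^ 'n::finite) \<times> real) set"
  assumes "quadrature_exact X f"
  shows "quadrature_exact X (\<lambda>x. c * f x)"
proof -
  have "1 / measure surface_measure (hemisphere :: ((real ^ 'n) \<times> real) set) *
      (LINT x:hemisphere|surface_measure. f x) = 1 / real (card X) * (\<Sum>x\<in>X. f x)"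
    using assms by (simp only: quadrature_exact_def)
  then show ?thesis
    using assms unfolding quadrature_exact_def
    by (simp only: set_integral_mult_right sum_distrib_left[symmetric] mult.left_commute[of _ c])
      (auto intro!: set_integrable_mult_right)
qed

lemma quadrature_exact_sum:
  assumes "\<And>i. i \<in> I \<Longrightarrow> quadrature_exact X (f i)"
  shows "quadrature_exact X (\<lambda>x. \<Sum>i\<in>I. f i x)"
  using assms
  by (induction I rule: infinite_finite_induct)
     (auto intro: quadrature_exact_zero quadrature_exact_add)

lemma hemisphere_area_nonzero:
  fixes Y :: "int list \<Rightarrow> real ^ 'n::finite \<Rightarrow> real"
  assumes d: "CARD('n) \<ge> 2" and Y: "spherical_harmonic_system Y"
  shows "measure surface_measure (hemisphere :: ((real ^ 'n) \<times> real) set) \<noteq> 0"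
proof -
  have one: "(\<lambda>_. 1) \<in> (homogeneous_polynomials 0 :: (real ^ 'n \<Rightarrow> real) set)"
    using homogeneous_polynomials_monomial[of "\<lambda>_. 0" 0 1] by (simp add: monomial_def monomial_degree_def)
  have "measure surface_measure (hemisphere :: ((real ^ 'n) \<times> real) set) =
      (LINT z:(hemisphere :: ((real ^ 'n) \<times> real) set)|surface_measure. 1 * poly 1 (snd z))"
    by (simp add: set_lebesgue_integral_def)
  also have "\<dots> = integral {0..1} (\<lambda>s. poly 1 s * (1 - s\<^sup>2) powr ((real 0 + CARD('n)) / 2 - 1)) *
      (LINT y:sphere (0 :: real ^ 'n) 1|surface_measure. 1)"
    by (rule hemisphere_integral_poly[OF one d])
  also have "\<dots> = integral {0..1} (\<lambda>s. (poly 1 s)\<^sup>2 * (1 - s\<^sup>2) powr lam CARD('n) 0) *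
      measure surface_measure (sphere (0 :: real ^ 'n) 1)"
    by (simp add: lam_def diff_divide_distrib set_lebesgue_integral_def)
  finally show ?thesis
    using weight_integral_pos[of 1 "CARD('n)" 0] d harmonic_system_constant(2)[OF d Y] by simp
qed

text \<open>
  For positive \<open>index_degree k\<close> the equatorial factor vanishes; otherwise the factor in the height does,
  because \<open>p_poly d l 0\<close> is orthogonal to \<open>1\<close>.
\<close>

lemma B_fun_integral_zero:
  fixes Y :: "int list \<Rightarrow> real ^ 'n::finite \<Rightarrow> real"
  assumes d: "CARD('n) \<ge> 2" and Y: "spherical_harmonic_system Y"
    and k: "k \<in> index_set CARD('n) l" and l: "l \<ge> 1"
  shows "set_integrable surface_measure hemisphere (B_fun Y l k)"
    and "(LINT z:hemisphere|surface_measure. B_fun Y l k z) = 0"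
proof -
  obtain H q where H: "H \<in> homogeneous_polynomials (index_degree k)" "\<And>u. u \<in> sphere 0 1 \<Longrightarrow> Y k u = H u"
    "index_degree k + degree q = l"
    "\<And>z. z \<in> hemisphere \<Longrightarrow> B_fun Y l k z = H (fst z) * poly q (snd z)"
    "\<And>s. poly q s = Psi CARD('n) (l - index_degree k) (index_degree k) s"
    using B_fun_polynomial[OF d Y k] by blast
  have "set_integrable surface_measure hemisphere (\<lambda>z :: (real ^ 'n) \<times> real. H (fst z) * poly q (snd z))"
    by (intro set_integrable_surface_measure closed_hemisphere hemisphere_subset_sphere continuous_intros
        continuous_on_compose2[OF homogeneous_polynomials_continuous[OF H(1), of UNIV]]) auto
  moreover have "set_integrable surface_measure hemisphere (B_fun Y l k) \<longleftrightarrow>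
      set_integrable surface_measure hemisphere (\<lambda>z :: (real ^ 'n) \<times> real. H (fst z) * poly q (snd z))"
    by (rule set_integrable_cong[OF refl refl H(4)])
  ultimately show "set_integrable surface_measure hemisphere (B_fun Y l k)" by simp
  have "(LINT z:hemisphere|surface_measure. B_fun Y l k z) =
      (LINT z:hemisphere|surface_measure. H (fst z) * poly q (snd z))"
    by (rule set_lebesgue_integral_cong) (auto simp: H(4) sets_hemisphere[simplified])
  also have "\<dots> = integral {0..1} (\<lambda>s. poly q s * (1 - s\<^sup>2) powr ((real (index_degree k) + CARD('n)) / 2 - 1)) *
      (LINT y:sphere 0 1|surface_measure. H y)"
    by (rule hemisphere_integral_poly[OF H(1) d])
  also have "\<dots> = 0"
  proof (cases "index_degree k = 0")
    case True
    obtain r where r: "r > 0" "\<And>x. Psi CARD('n) l 0 x = p_poly CARD('n) l 0 x / r"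
      using Psi_eq[OF d, of l 0] by blast
    have "integral {0..1} (\<lambda>s. poly q s * (1 - s\<^sup>2) powr ((real (index_degree k) + CARD('n)) / 2 - 1)) =
        integral {0..1} (\<lambda>s. p_poly CARD('n) l 0 s * (1 - s\<^sup>2) powr lam CARD('n) 0 / r)"
      using True r by (simp add: H(5) lam_def diff_divide_distrib)
    also have "\<dots> = 0" using p_poly_orthogonal_1[OF d, of l 0] l by simp
    finally show ?thesis by simp
  next
    case False
    have "(LINT y:sphere 0 1|surface_measure. H y) = (LINT y:sphere 0 1|surface_measure. Y k y)"
      by (rule set_lebesgue_integral_cong) (auto simp: H(2))
    then show ?thesis using harmonic_system_mean_zero[OF d Y k] False by simp
  qed
  finally show "(LINT z:hemisphere|surface_measure. B_fun Y l k z) = 0" .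
qed

lemma quadrature_exact_B_fun_iff:
  fixes Y :: "int list \<Rightarrow> real ^ 'n::finite \<Rightarrow> real"
  assumes d: "CARD('n) \<ge> 2" and Y: "spherical_harmonic_system Y"
    and k: "k \<in> index_set CARD('n) l" and l: "l \<ge> 1" and X: "finite X" "X \<noteq> {}"
  shows "quadrature_exact X (B_fun Y l k) \<longleftrightarrow> (\<Sum>x\<in>X. B_fun Y l k x) = 0"
  unfolding quadrature_exact_def using B_fun_integral_zero[OF d Y k l] X by simp

text \<open>
  A function of degree \<open>0\<close> is constant on the hemisphere, and every average preserves constants.
\<close>

lemma quadrature_exact_B_fun_0:
  fixes Y :: "int list \<Rightarrow> real ^ 'n::finite \<Rightarrow> real"
  assumes d: "CARD('n) \<ge> 2" and Y: "spherical_harmonic_system Y"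
    and k: "k \<in> index_set CARD('n) 0" and X: "finite X" "X \<noteq> {}" "X \<subseteq> hemisphere"
  shows "quadrature_exact X (B_fun Y 0 k)"
proof -
  obtain H q where H: "H \<in> homogeneous_polynomials (index_degree k)" "\<And>u. u \<in> sphere 0 1 \<Longrightarrow> Y k u = H u"
    "index_degree k + degree q = 0"
    "\<And>z. z \<in> hemisphere \<Longrightarrow> B_fun Y 0 k z = H (fst z) * poly q (snd z)"
    "\<And>s. poly q s = Psi CARD('n) (0 - index_degree k) (index_degree k) s"
    using B_fun_polynomial[OF d Y k] by blast
  have "H y = H 0" for y using homogeneous_polynomials_scaleR[OF H(1), of 0 y] H(3) by simp
  moreover obtain a where "q = [:a:]" using H(3) by (auto elim: degree_eq_zeroE)
  ultimately have B: "B_fun Y 0 k z = H 0 * a" if "z \<in> hemisphere" for z using H(4)[OF that] by simp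
  have "set_integrable surface_measure hemisphere (\<lambda>z :: (real ^ 'n) \<times> real. H 0 * a)"
    by (intro set_integrable_surface_measure closed_hemisphere hemisphere_subset_sphere continuous_intros)
  then have "quadrature_exact X (\<lambda>_. H 0 * a)"
    using hemisphere_area_nonzero[OF d Y] X by (simp add: quadrature_exact_def set_lebesgue_integral_def)
  then show ?thesis by (rule quadrature_exact_cong[OF _ X(3) B])
qed

text \<open>
  On the hemisphere such a product is a linear combination of functions \<open>B_fun Y l k\<close> with \<open>l \<le> t\<close>:
  expand \<open>h\<close> in the spherical harmonics of degree \<open>m\<close>, and \<open>q\<close> in the functions \<open>Psi d r m\<close> with
  \<open>r \<le> t - m\<close>.
\<close>

lemma quadrature_exact_harmonic:
  fixes Y :: "int list \<Rightarrow> real ^ 'n::finite \<Rightarrow> real"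
  assumes d: "CARD('n) \<ge> 2" and Y: "spherical_harmonic_system Y"
    and X: "finite X" "X \<noteq> {}" "X \<subseteq> hemisphere"
    and zero: "\<And>l k. l \<in> {1..t} \<Longrightarrow> k \<in> index_set CARD('n) l \<Longrightarrow> (\<Sum>x\<in>X. B_fun Y l k x) = 0"
    and h: "h \<in> homogeneous_polynomials m" "\<And>x. laplacian h x = 0"
    and q: "m + degree q \<le> t"
  shows "quadrature_exact X (\<lambda>z. h (fst z) * poly q (snd z))"
proof -
  let ?K = "{k. k \<in> (\<Union>l. index_set CARD('n) l) \<and> index_degree k = m}"
  have exact: "quadrature_exact X (B_fun Y l k)" if "l \<le> t" "k \<in> index_set CARD('n) l" for l k
    using quadrature_exact_B_fun_iff[OF d Y that(2) _ X(1,2)] quadrature_exact_B_fun_0[OF d Y _ X] zero[of l k] that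
    by (cases "l = 0") auto
  have "restrict h (sphere 0 1) \<in> spherical_harmonics m"
    unfolding spherical_harmonics_def using h by blast
  then obtain c where c: "\<And>u. u \<in> sphere 0 1 \<Longrightarrow> h u = (\<Sum>k\<in>?K. c k * Y k u)"
    using spherical_harmonic_systemD(3)[OF Y] by force
  have deg: "degree q \<le> t - m" using q by simp
  obtain e where e: "\<And>x. poly q x = (\<Sum>r\<le>t - m. e r * Psi CARD('n) r m x)"
    using poly_in_span_Psi[OF d deg, of m] by blast
  have "quadrature_exact X (\<lambda>z. \<Sum>k\<in>?K. \<Sum>r\<le>t - m. (c k * e r) * B_fun Y (m + r) k z)"
  proof (intro quadrature_exact_sum quadrature_exact_cmult exact)
    fix k r assume "k \<in> ?K" "r \<in> {..t - m}"
    then show "m + r \<le> t" "k \<in> index_set CARD('n) (m + r)"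
      using q index_set_of_degree_le[of k "CARD('n)" "m + r"] by auto
  qed
  moreover have "h (fst z) * poly q (snd z) = (\<Sum>k\<in>?K. \<Sum>r\<le>t - m. (c k * e r) * B_fun Y (m + r) k z)"
    if z: "z \<in> hemisphere" for z
  proof -
    obtain u \<theta> where u: "u \<in> sphere 0 1" and \<theta>: "\<theta> \<in> {0..pi/2}" and zz: "z = (sin \<theta> *\<^sub>R u, cos \<theta>)"
      using hemisphere_polar[OF z] by blast
    have "B_fun Y (m + r) k z = sin \<theta> ^ m * Psi CARD('n) r m (cos \<theta>) * Y k u" if "k \<in> ?K" for r k
      using that unfolding zz
      by (subst B_fun_polar[OF Y index_set_of_degree_le u \<theta>]) auto
    then have "(\<Sum>k\<in>?K. \<Sum>r\<le>t - m. (c k * e r) * B_fun Y (m + r) k z) =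
        (\<Sum>k\<in>?K. \<Sum>r\<le>t - m. (c k * Y k u) * (sin \<theta> ^ m * (e r * Psi CARD('n) r m (cos \<theta>))))"
      by (intro sum.cong refl) simp
    also have "\<dots> = (\<Sum>k\<in>?K. c k * Y k u) * (sin \<theta> ^ m * (\<Sum>r\<le>t - m. e r * Psi CARD('n) r m (cos \<theta>)))"
      by (simp only: sum_distrib_left sum_distrib_right) (subst sum.swap, rule refl)?
    also have "\<dots> = h (fst z) * poly q (snd z)"
      by (simp only: zz fst_conv snd_conv homogeneous_polynomials_scaleR[OF h(1)] c[OF u] e) (simp add: mult_ac)
    finally show ?thesis by simp
  qed
  ultimately show ?thesis by (rule quadrature_exact_cong[OF _ X(3)])
qed

text \<open>
  A monomial is a homogeneous polynomial in the equatorial variables times a power of the height \<open>s\<close>.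
  In the harmonic decomposition of the former, \<open>\<bar>y\<bar>\<^sup>2\<close> equals \<open>1 - s\<^sup>2\<close> on the sphere, so every summand
  becomes a harmonic polynomial times a polynomial in \<open>s\<close>; the total degree does not grow.
\<close>

lemma quadrature_exact_polynomial:
  fixes Y :: "int list \<Rightarrow> real ^ 'n::finite \<Rightarrow> real"
  assumes d: "CARD('n) \<ge> 2" and Y: "spherical_harmonic_system Y"
    and X: "finite X" "X \<noteq> {}" "X \<subseteq> hemisphere"
    and zero: "\<And>l k. l \<in> {1..t} \<Longrightarrow> k \<in> index_set CARD('n) l \<Longrightarrow> (\<Sum>x\<in>X. B_fun Y l k x) = 0"
    and p: "p \<in> polynomials_le t"
  shows "quadrature_exact X p"
  using p unfolding polynomials_le_eq
proof (induction rule: monomial_combinations_induct)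
  case zero
  show ?case by (rule quadrature_exact_zero)
next
  case (step c \<alpha> p)
  define j where "j = \<alpha> (0, 1)"
  define m where "m = monomial_degree (\<lambda>u. \<alpha> (u, 0))"
  have mj: "m + j \<le> t" using step(1) by (simp add: monomial_degree_prod m_def j_def)
  have "monomial (\<lambda>u. \<alpha> (u, 0)) \<in> homogeneous_polynomials m"
    using homogeneous_polynomials_monomial[of "\<lambda>u. \<alpha> (u, 0)" m 1] by (simp add: m_def)
  from harmonic_decomposition[OF this] obtain h
    where h: "\<And>i. i \<le> m div 2 \<Longrightarrow> h i \<in> homogeneous_polynomials (m - 2 * i)"
      "\<And>i x. i \<le> m div 2 \<Longrightarrow> laplacian (h i) x = 0"
      "\<And>x. monomial (\<lambda>u. \<alpha> (u, 0)) x = (\<Sum>i\<le>m div 2. inner x x ^ i * h i x)" by blast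
  define q where "q i = [:1, 0, -1:] ^ i * Polynomial.monom (1::real) j" for i :: nat
  have "quadrature_exact X (\<lambda>z. \<Sum>i\<le>m div 2. h i (fst z) * poly (q i) (snd z))"
  proof (intro quadrature_exact_sum quadrature_exact_harmonic[OF d Y X zero])
    fix i assume "i \<in> {..m div 2}"
    then have i: "i \<le> m div 2" by simp
    show "h i \<in> homogeneous_polynomials (m - 2 * i)" "laplacian (h i) x = 0" for x using h i by auto
    have "degree (q i) \<le> 2 * i + j"
      unfolding q_def by (intro order.trans[OF degree_mult_le] add_mono order.trans[OF degree_power_le] degree_monom_le) simp
    then show "m - 2 * i + degree (q i) \<le> t" using mj i by simp
  qed
  moreover have "monomial \<alpha> z = (\<Sum>i\<le>m div 2. h i (fst z) * poly (q i) (snd z))" if "z \<in> hemisphere" for z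
  proof -
    have "inner (fst z) (fst z) + snd z * snd z = 1"
      using that norm_eq_1[of z] by (auto simp: hemisphere_def inner_prod_def)
    then have eq: "inner (fst z) (fst z) = 1 - snd z * snd z" by simp
    have "poly (q i) s = (1 - s * s) ^ i * s ^ j" for i s
      by (simp add: q_def poly_monom)
    then show ?thesis
      unfolding monomial_prod h(3) j_def[symmetric] eq sum_distrib_right
      by (intro sum.cong refl) (simp add: mult_ac)
  qed
  ultimately have "quadrature_exact X (monomial \<alpha>)" by (rule quadrature_exact_cong[OF _ X(3)])
  then show ?case by (intro quadrature_exact_add quadrature_exact_cmult step)
qed

theorem theorem2p1:
  fixes X :: "((real ^ 'n::finite) \<times> real) set"
    and Y :: "int list \<Rightarrow> real ^ 'n \<Rightarrow> real"
    and t :: nat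
  assumes "CARD('n) \<ge> 2"
    and "t \<ge> 1"
    and "spherical_harmonic_system Y"
    and "finite X" and "X \<noteq> {}" and "X \<subseteq> hemisphere"
  shows "hemispherical_design t X \<longleftrightarrow>
    (\<forall>l\<in>{1..t}. \<forall>k\<in>index_set CARD('n) l. (\<Sum>x\<in>X. B_fun Y l k x) = 0)"
proof
  assume design: "hemispherical_design t X"
  show "\<forall>l\<in>{1..t}. \<forall>k\<in>index_set CARD('n) l. (\<Sum>x\<in>X. B_fun Y l k x) = 0"
  proof (intro ballI)
    fix l k assume l: "l \<in> {1..t}" and k: "k \<in> index_set CARD('n) l"
    obtain H q where H: "H \<in> homogeneous_polynomials (index_degree k)" "\<And>u. u \<in> sphere 0 1 \<Longrightarrow> Y k u = H u"
      "index_degree k + degree q = l"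
      "\<And>z. z \<in> hemisphere \<Longrightarrow> B_fun Y l k z = H (fst z) * poly q (snd z)"
      "\<And>s. poly q s = Psi CARD('n) (l - index_degree k) (index_degree k) s"
      using B_fun_polynomial[OF assms(1,3) k] by blast
    let ?P = "restrict (\<lambda>z. H (fst z) * poly q (snd z)) (sphere (0 :: (real ^ 'n) \<times> real) 1)"
    have "?P \<in> spherical_polynomials t"
      unfolding spherical_polynomials_def using H(3) l by (intro imageI polynomials_le_product[OF H(1)]) simp
    moreover have P: "B_fun Y l k z = ?P z" if "z \<in> hemisphere" for z
      using H(4)[OF that] that hemisphere_subset_sphere by auto
    then have "set_integrable surface_measure hemisphere (B_fun Y l k) \<longleftrightarrow>
        set_integrable surface_measure hemisphere ?P"
      by (rule set_integrable_cong[OF refl refl])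
    then have "set_integrable surface_measure hemisphere ?P"
      using B_fun_integral_zero(1)[OF assms(1,3) k] l by simp
    ultimately have "quadrature_exact X ?P"
      using design unfolding hemispherical_design_def quadrature_exact_def by blast
    then have "quadrature_exact X (B_fun Y l k)" by (rule quadrature_exact_cong[OF _ assms(6) P])
    then show "(\<Sum>x\<in>X. B_fun Y l k x) = 0"
      using quadrature_exact_B_fun_iff[OF assms(1,3) k _ assms(4,5)] l by simp
  qed
next
  assume zero: "\<forall>l\<in>{1..t}. \<forall>k\<in>index_set CARD('n) l. (\<Sum>x\<in>X. B_fun Y l k x) = 0"
  have "quadrature_exact X P" if P: "P \<in> spherical_polynomials t" for P
  proof -
    obtain p where p: "p \<in> polynomials_le t" "P = restrict p (sphere 0 1)"
      using P unfolding spherical_polynomials_def by blast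
    have "quadrature_exact X p"
      using zero by (intro quadrature_exact_polynomial[OF assms(1,3-6) _ p(1)]) auto
    moreover have "P z = p z" if "z \<in> hemisphere" for z
      using that hemisphere_subset_sphere by (auto simp: p(2))
    ultimately show ?thesis by (rule quadrature_exact_cong[OF _ assms(6)])
  qed
  then show "hemispherical_design t X"
    using assms by (simp add: hemispherical_design_def quadrature_exact_def)
qed

end
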